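(* Let $n,m\geq 1$ and let $(S_1,\dots,S_{n+m})$ be an exchangeable random vector of real scores with almost surely no ties. Define $p_i=\frac{1}{n+1}\big(1+\sum_{j=1}^n\mathbf{1}\{S_j\geq S_{n+i}\}\big)$, $i\in\{1,\dots,m\}$, $\widehat{F}_m(t)=m^{-1}\sum_{i=1}^m\mathbf{1}\{p_i\leq t\}$ and $I_n(t)=\lfloor (n+1)t\rfloor/(n+1)$ for $t\in[0,1]$. Then for all $\lambda>0$, $$\mathbb{P}\Big(\sup_{t\in[0,1]}\big(\widehat{F}_m(t)-I_n(t)\big)>\lambda\Big)\leq B^{\mathrm{DKW}}(\lambda,n,m),$$ where, with $\tau_{n,m}=nm/(n+m)$, $$B^{\mathrm{DKW}}(\lambda,n,m)=\mathbf{1}\{\lambda<1\}\Big[1+\frac{2\sqrt{2\pi}\,\lambda\,\tau_{n,m}}{(n+m)^{1/2}}\Big]e^{-2\tau_{n,m}\lambda^2}.$$ In addition, for every $\delta\in(0,1)$ and every integer $r\geq1$, $B^{\mathrm{DKW}}(\lambda^{\mathrm{DKW}}_{\delta,n,m},n,m)\leq\delta$, where $\lambda^{\mathrm{DKW}}_{\delta,n,m}=\Psi^{(r)}(1)$, $\Psi^{(r)}$ denotes $\Psi$ iterated $r$ times, and $$\Psi(x)=1\wedge\bigg(\frac{\log(1/\delta)+\log\big(1+\sqrt{2\pi}\,\frac{2\tau_{n,m}x}{(n+m)^{1/2}}\big)}{2\tau_{n,m}}\bigg)^{1/2}.$$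
   Context: Exchangeable means the joint distribution is invariant under permutations of the coordinates. *)

theory Defs
  imports "HOL-Probability.Probability"
begin

text \<open>Scores are indexed by 1..N (N = n+m); the random vector is S 1, ..., S N.\<close>

definition exchangeable :: "'a measure \<Rightarrow> nat set \<Rightarrow> (nat \<Rightarrow> 'a \<Rightarrow> real) \<Rightarrow> bool" where
  "exchangeable M I S \<longleftrightarrow>
     (\<forall>\<sigma>. \<sigma> permutes I \<longrightarrow>
        distr M (PiM I (\<lambda>_. borel)) (\<lambda>\<omega>. \<lambda>i\<in>I. S (\<sigma> i) \<omega>)
      = distr M (PiM I (\<lambda>_. borel)) (\<lambda>\<omega>. \<lambda>i\<in>I. S i \<omega>))"

definition no_ties :: "'a measure \<Rightarrow> nat set \<Rightarrow> (nat \<Rightarrow> 'a \<Rightarrow> real) \<Rightarrow> bool" where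
  "no_ties M I S \<longleftrightarrow> (AE \<omega> in M. \<forall>i\<in>I. \<forall>j\<in>I. i \<noteq> j \<longrightarrow> S i \<omega> \<noteq> S j \<omega>)"

definition pval :: "nat \<Rightarrow> (nat \<Rightarrow> 'a \<Rightarrow> real) \<Rightarrow> nat \<Rightarrow> 'a \<Rightarrow> real" where
  "pval n S i \<omega> = (1 + real (card {j \<in> {1..n}. S j \<omega> \<ge> S (n + i) \<omega>})) / (real n + 1)"

definition Fhat :: "nat \<Rightarrow> nat \<Rightarrow> (nat \<Rightarrow> 'a \<Rightarrow> real) \<Rightarrow> real \<Rightarrow> 'a \<Rightarrow> real" where
  "Fhat n m S t \<omega> = real (card {i \<in> {1..m}. pval n S i \<omega> \<le> t}) / real m"

definition In_fun :: "nat \<Rightarrow> real \<Rightarrow> real" where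
  "In_fun n t = real_of_int \<lfloor>(real n + 1) * t\<rfloor> / (real n + 1)"

definition tau :: "nat \<Rightarrow> nat \<Rightarrow> real" where
  "tau n m = real n * real m / (real n + real m)"

definition B_DKW :: "real \<Rightarrow> nat \<Rightarrow> nat \<Rightarrow> real" where
  "B_DKW lam n m = (if lam < 1 then 1 else 0) *
     (1 + 2 * sqrt (2 * pi) * lam * tau n m / sqrt (real n + real m)) * exp (- 2 * tau n m * lam\<^sup>2)"

definition Psi_DKW :: "real \<Rightarrow> nat \<Rightarrow> nat \<Rightarrow> real \<Rightarrow> real" where
  "Psi_DKW \<delta> n m x = min 1 (sqrt ((ln (1 / \<delta>) + ln (1 + sqrt (2 * pi) * (2 * tau n m * x / sqrt (real n + real m))))
                                   / (2 * tau n m)))"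

definition lambda_DKW :: "real \<Rightarrow> nat \<Rightarrow> nat \<Rightarrow> nat \<Rightarrow> real" where
  "lambda_DKW \<delta> n m r = (Psi_DKW \<delta> n m ^^ r) 1"

end

theory Submission
  imports Defs
begin

text \<open>
  Order the scores decreasingly and read them as a lattice path with \<open>n\<close> calibration and \<open>m\<close> test
  steps. By exchangeability the path is uniform, and the event forces it to visit a point
  \<open>(a, b)\<close> with \<open>b / m > \<lambda> + (a + 1) / (n + 1)\<close>. Compare with a uniform path to \<open>(n + y, m)\<close>: at the
  last such visit the likelihood ratio is a quotient of products
  \<open>\<Prod>j<b. 1 + y / (a + 1 + j)\<close>, so the probability is at most \<open>exp (- 2 \<tau> \<lambda>\<^sup>2)\<close> as soon as one \<open>y\<close>
  makes this ratio at least \<open>exp (2 \<tau> \<lambda>\<^sup>2)\<close> along the whole boundary. After replacing sums by integrals, \<open>y\<close> is chosen through the saddle point of the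
  hypergeometric rate function: along the boundary the tilted rate is then minimal at the
  saddle, where it is a Jensen--Shannon divergence and hence at least \<open>2 \<tau>' \<lambda>\<^sup>2\<close>, where
  \<open>\<tau>' = (n + 1) m / (n + m + 1)\<close>. The errors of the trapezoidal rule are absorbed by \<open>\<tau>' - \<tau>\<close>
  for \<open>\<lambda> \<ge> 1 / 4\<close>, and otherwise by the boundary terms of that rule.
\<close>

subsection \<open>The rate function along the boundary\<close>

definition xlnx :: "real \<Rightarrow> real" where "xlnx x = x * ln x"

lemma xlnx_mult: "a > 0 \<Longrightarrow> b > 0 \<Longrightarrow> xlnx (a * b) = a * xlnx b + b * xlnx a"
  by (simp add: xlnx_def ln_mult algebra_simps)

lemma xlnx_deriv [derivative_intros]:
  assumes "(f has_real_derivative f') (at x within A)" "f x > 0"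
  shows "((\<lambda>x. xlnx (f x)) has_real_derivative f' * (ln (f x) + 1)) (at x within A)"
  unfolding xlnx_def using assms
  by (auto intro!: derivative_eq_intros simp: field_simps)

text \<open>The second derivative of the negative binary entropy is at least 4, with equality at
  1/2. This is the constant of Pinsker's inequality and the source of the 2 in the exponent of
  \<open>B_DKW\<close>.\<close>

lemma convex_binary_entropy_minus_square:
  "convex_on {0<..<1} (\<lambda>x. xlnx x + xlnx (1 - x) - 2 * x\<^sup>2)"
proof (rule f''_ge0_imp_convex)
  fix x :: real assume x: "x \<in> {0<..<1}"
  show "((\<lambda>x. xlnx x + xlnx (1 - x) - 2 * x\<^sup>2) has_real_derivative ln x - ln (1 - x) - 4 * x) (at x)"
    using x by (auto intro!: derivative_eq_intros simp: algebra_simps)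
  show "((\<lambda>x. ln x - ln (1 - x) - 4 * x) has_real_derivative 1 / x + 1 / (1 - x) - 4) (at x)"
    using x by (auto intro!: derivative_eq_intros simp: field_simps)
  have "1 / x + 1 / (1 - x) - 4 = (2 * x - 1)\<^sup>2 / (x * (1 - x))"
    using x by (simp add: field_simps power2_eq_square)
  also have "\<dots> \<ge> 0" using x by simp
  finally show "1 / x + 1 / (1 - x) - 4 \<ge> 0" .
qed auto

text \<open>The left side is the Jensen--Shannon divergence, with weights p and q, of the Bernoulli
  laws with parameters s + q l and s - p l; their mixture has parameter s. Jensen's inequality for
  the convex function above leaves twice the weighted variance p q l^2 of the two
  parameters.\<close>

lemma jensen_shannon_ge:
  fixes p q s l :: real
  assumes "p > 0" "q > 0" "p + q = 1" "l > 0" "s - p * l > 0" "s + q * l < 1"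
  shows "p * xlnx (s + q * l) + q * xlnx (s - p * l) - xlnx s
       + (q * xlnx (1 - s + p * l) + p * xlnx (1 - s - q * l) - xlnx (1 - s)) \<ge> 2 * p * q * l\<^sup>2"
proof -
  let ?W = "\<lambda>x. xlnx x + xlnx (1 - x) - 2 * x\<^sup>2"
  have pl: "p * l > 0" "q * l > 0" using assms by auto
  have mem: "s + q * l \<in> {0<..<1}" "s - p * l \<in> {0<..<1}" using pl assms(5,6) by auto
  have "?W ((1 - q) *\<^sub>R (s + q * l) + q *\<^sub>R (s - p * l)) \<le> (1 - q) * ?W (s + q * l) + q * ?W (s - p * l)"
    by (rule convex_onD[OF convex_binary_entropy_minus_square]) (use assms mem in auto)
  moreover have "(1 - q) *\<^sub>R (s + q * l) + q *\<^sub>R (s - p * l) = s"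
  proof -
    have p: "p = 1 - q" using assms by simp
    show ?thesis unfolding p by (simp add: algebra_simps)
  qed
  moreover have p: "1 - q = p" using assms by simp
  moreover have "p * (2 * (s + q * l)\<^sup>2) + q * (2 * (s - p * l)\<^sup>2) - 2 * s\<^sup>2 = 2 * p * q * l\<^sup>2"
  proof -
    have q: "q = 1 - p" using assms by simp
    show ?thesis unfolding q by (simp add: power2_eq_square algebra_simps)
  qed
  moreover have "1 - (s + q * l) = 1 - s - q * l" "1 - (s - p * l) = 1 - s + p * l" by auto
  ultimately show ?thesis by (simp add: algebra_simps)
qed

text \<open>As a function of \<open>1 / x\<close> the derivative vanishes at \<open>0\<close> and is unimodal, hence it changes
  sign at most once.\<close>

lemma tilted_rate_slope_sign:
  fixes p q l e w0 :: real
  defines "Z \<equiv> \<lambda>w. ln (1 + (p * l + e) * w) - ln (1 + p * l * w) - q * ln (1 + e * w / q)"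
  assumes pq: "p > 0" "q > 0" "p + q = 1" and l: "l > 0" and e: "e > 0"
    and w0: "w0 > 0" "Z w0 = 0"
  shows "0 < w \<Longrightarrow> w \<le> w0 \<Longrightarrow> Z w \<ge> 0" and "w0 \<le> w \<Longrightarrow> Z w \<le> 0"
proof -
  define Z' where "Z' w = e * p * w * (e / q - 2 * l - l * (p * l + e) * w) /
      ((1 + (p * l + e) * w) * (1 + p * l * w) * (1 + e * w / q))" for w
  have pos: "1 + (p * l + e) * w > 0" "1 + p * l * w > 0" "1 + e * w / q > 0" if "w \<ge> 0" for w
    using that pq l e by (auto intro!: add_pos_nonneg mult_nonneg_nonneg divide_nonneg_nonneg)
  have DZ: "(Z has_real_derivative Z' w) (at w)" if w: "w \<ge> 0" for w
  proof -
    have "(Z has_real_derivative (p * l + e) / (1 + (p * l + e) * w) - p * l / (1 + p * l * w)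
       - e / (1 + e * w / q)) (at w)"
    proof -
      have ln1: "((\<lambda>w. ln (1 + c * w)) has_real_derivative c / (1 + c * w)) (at w)" if "1 + c * w > 0" for c
        using that by (auto intro!: derivative_eq_intros)
      show ?thesis
        using ln1[of "p * l + e"] ln1[of "p * l"] DERIV_cmult[OF ln1[of "e / q"], of q] pos[OF w] pq
        unfolding Z_def by (auto intro!: DERIV_diff)
    qed
    moreover have "(p * l + e) / (1 + (p * l + e) * w) - p * l / (1 + p * l * w) - e / (1 + e * w / q) = Z' w"
    proof -
      define X where "X = 1 + (p * l + e) * w"
      define Y where "Y = 1 + p * l * w"
      define V where "V = 1 + e * w / q"
      have ne: "X \<noteq> 0" "Y \<noteq> 0" "V \<noteq> 0" using pos[OF w] by (auto simp: X_def Y_def V_def)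
      have "(p * l + e) * Y - p * l * X = e"
        by (simp add: X_def Y_def algebra_simps)
      then have "(p * l + e) / X - p * l / Y = e / (X * Y)"
        using ne by (simp add: field_simps)
      then have "(p * l + e) / X - p * l / Y - e / V = e * (V - X * Y) / (X * Y * V)"
        using ne by (simp add: field_simps)
      moreover have "V - X * Y = p * w * (e / q - 2 * l - l * (p * l + e) * w)"
      proof -
        have "1 / q = 1 + p / q" using pq by (simp add: field_simps)
        then have "e * w / q = e * w * (1 + p / q)" by (metis mult.right_neutral times_divide_eq_right)
        then show ?thesis unfolding V_def X_def Y_def by (simp add: algebra_simps)
      qed
      ultimately show ?thesis by (simp add: Z'_def X_def Y_def V_def mult_ac)
    qed
    ultimately show ?thesis by simp
  qed
  have Z0: "Z 0 = 0" by (simp add: Z_def)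
  \<comment> \<open>The zero of the linear factor of \<open>Z'\<close>: on the positive axis
    \<open>Z\<close> rises before \<open>w1\<close> and falls after it.\<close>
  define w1 where "w1 = (e / q - 2 * l) / (l * (p * l + e))"
  have ple: "p * l + e > 0" using pq l e by (simp add: add_pos_pos)
  with l have pl: "l * (p * l + e) > 0" by simp
  have fac: "e / q - 2 * l - l * (p * l + e) * w = l * (p * l + e) * (w1 - w)" for w
  proof -
    have "l * (p * l + e) * w1 = e / q - 2 * l" using pl unfolding w1_def
      by (subst times_divide_eq_right, subst nonzero_mult_div_cancel_left) auto
    then show ?thesis by (simp only: right_diff_distrib)
  qed
  have Z'_eq: "Z' w = (e * p * w * (l * (p * l + e))) * (w1 - w) /
      ((1 + (p * l + e) * w) * (1 + p * l * w) * (1 + e * w / q))" for w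
    unfolding Z'_def fac by (simp add: mult_ac)
  have Z'_pos: "Z' w > 0" if "w > 0" "w < w1" for w
    unfolding Z'_eq using that pos[of w] ple pq l e by (intro divide_pos_pos mult_pos_pos) auto
  have Z'_neg: "Z' w < 0" if "w > 0" "w > w1" for w
    unfolding Z'_eq using that pos[of w] ple pq l e
    by (intro divide_neg_pos mult_pos_neg mult_pos_pos) auto
  have cont: "continuous_on {a..b} Z" if "a \<ge> 0" for a b
  proof (rule DERIV_continuous_on)
    show "(Z has_real_derivative Z' x) (at x within {a..b})" if "x \<in> {a..b}" for x
      using DZ[of x] that \<open>a \<ge> 0\<close> by (auto intro: has_field_derivative_at_within)
  qed
  have inc: "Z a < Z b" if "0 \<le> a" "a < b" "b \<le> w1" for a b
  proof (rule DERIV_pos_imp_increasing_open[OF that(2)])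
    fix x assume "a < x" "x < b"
    then show "\<exists>y. (Z has_real_derivative y) (at x) \<and> 0 < y"
      using that DZ[of x] Z'_pos[of x] by (intro exI[of _ "Z' x"]) auto
  qed (use that cont in auto)
  have dec: "Z b < Z a" if "0 \<le> a" "a < b" "w1 \<le> a" for a b
  proof (rule DERIV_neg_imp_decreasing_open[OF that(2)])
    fix x assume "a < x" "x < b"
    then show "\<exists>y. (Z has_real_derivative y) (at x) \<and> y < 0"
      using that DZ[of x] Z'_neg[of x] by (intro exI[of _ "Z' x"]) auto
  qed (use that cont in auto)
  \<comment> \<open>Otherwise \<open>Z\<close> would fall strictly from \<open>Z 0 = 0\<close> and
    could not be 0 at \<open>w0\<close>. The next fact excludes in the same way that
    \<open>Z\<close> only rises up to \<open>w0\<close>.\<close>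
  have w1_pos: "w1 > 0"
    using dec[of 0 w0] w0 Z0 by force
  have w01: "w1 < w0"
    using inc[of 0 w0] w0 Z0 by force
  show "Z w \<ge> 0" if "0 < w" "w \<le> w0"
  proof (cases "w \<le> w1")
    case True
    then show ?thesis using inc[of 0 w] Z0 that by simp
  next
    case False
    then show ?thesis using dec[of w w0] w0 that w1_pos by (cases "w = w0") auto
  qed
  show "Z w \<le> 0" if "w0 \<le> w"
    using dec[of w0 w] w0 w01 that by (cases "w = w0") auto
qed

text \<open>Under the stationarity hypothesis \<open>f\<close> is concave for large x, so convexity
  cannot identify the minimum. Instead the derivative at x is \<open>Z (1 / x)\<close>, and the sign
  pattern of \<open>Z\<close> makes \<open>f\<close> decrease up to a and increase
  afterwards.\<close>

lemma tilted_rate_min: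
  fixes p q l e a x :: real
  defines "f \<equiv> \<lambda>x. xlnx (x + p * l + e) + xlnx (q * x) - xlnx (x + p * l) - xlnx (q * x + e)"
  assumes pq: "p > 0" "q > 0" "p + q = 1" and l: "l > 0" and e: "e > 0" and a: "a > 0"
    and stat: "ln (a + p * l + e) + q * ln (q * a) - ln (a + p * l) - q * ln (q * a + e) = 0"
    and x: "x > 0"
  shows "f a \<le> f x"
proof -
  define f' where "f' x = ln (x + p * l + e) + q * ln (q * x) - ln (x + p * l) - q * ln (q * x + e)" for x
  have pos: "x + p * l + e > 0" "x + p * l > 0" "q * x > 0" "q * x + e > 0" if "x > 0" for x
    using that pq l e by (auto intro!: add_pos_pos)
  have D: "(f has_real_derivative f' x) (at x)" if "x > 0" for x
  proof -
    have "(f has_real_derivative 1 * (ln (x + p * l + e) + 1) + q * (ln (q * x) + 1)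
        - 1 * (ln (x + p * l) + 1) - q * (ln (q * x + e) + 1)) (at x)"
      unfolding f_def using pos[OF that]
      by (intro DERIV_diff DERIV_add xlnx_deriv) (auto intro!: derivative_eq_intros)
    then show ?thesis by (simp add: f'_def algebra_simps)
  qed
  define Z where "Z w = ln (1 + (p * l + e) * w) - ln (1 + p * l * w) - q * ln (1 + e * w / q)" for w
  have f'_Z: "f' x = Z (1 / x)" if "x > 0" for x
  proof -
    have "1 + (p * l + e) * (1 / x) = (x + p * l + e) / x" "1 + p * l * (1 / x) = (x + p * l) / x"
      "1 + e * (1 / x) / q = (q * x + e) / (q * x)"
      using that pq by (simp_all add: field_simps)
    then show ?thesis
      unfolding Z_def f'_def using pos[OF that] that by (simp add: ln_div algebra_simps)
  qed
  have Z0: "Z (1 / a) = 0" using f'_Z[OF a] stat by (simp add: f'_def)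
  have sgn: "0 < w \<Longrightarrow> w \<le> 1 / a \<Longrightarrow> Z w \<ge> 0" "1 / a \<le> w \<Longrightarrow> Z w \<le> 0" for w
    using tilted_rate_slope_sign[OF pq l e, of "1 / a" w] Z0 a unfolding Z_def by simp_all
  show ?thesis
  proof (cases "x \<ge> a")
    case True
    show ?thesis
    proof (rule DERIV_nonneg_imp_nondecreasing[OF True])
      fix t assume t: "a \<le> t" "t \<le> x"
      have "f' t \<ge> 0" using f'_Z[of t] sgn(1)[of "1 / t"] a t by (simp add: frac_le)
      then show "\<exists>y. (f has_real_derivative y) (at t) \<and> 0 \<le> y" using D[of t] a t by auto
    qed
  next
    case False
    then have "x \<le> a" by simp
    then show ?thesis
    proof (rule DERIV_nonpos_imp_nonincreasing)
      fix t assume t: "x \<le> t" "t \<le> a"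
      have "f' t \<le> 0" using f'_Z[of t] sgn(2)[of "1 / t"] a t x by (simp add: frac_le)
      then show "\<exists>y. (f has_real_derivative y) (at t) \<and> y \<le> 0" using D[of t] t x by auto
    qed
  qed
qed

section \<open>The saddle point and the choice of the tilt\<close>

definition jensen_gap :: "real \<Rightarrow> real \<Rightarrow> real \<Rightarrow> real" where
  "jensen_gap l p x = ln (x + p * l) - (1 - p) * ln x - p * ln (x + l)"

text \<open>As x tends to 0 from the right, \<open>(1 - p) * - ln x\<close> blows up, while all
  other terms, collected in \<open>h\<close>, are continuous at 0. The lemma supplies end points for
  an intermediate value argument.\<close>

lemma jensen_gap_eventually_greater:
  assumes "0 < p" "p < 1" "0 < l" "l < 1" "0 < c"
  shows "\<exists>x>0. x < c \<and> x < 1 - l \<and> jensen_gap l (1 - p) (1 - l - x) < jensen_gap l p x"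
proof -
  define h where "h x = ln (x + p * l) - p * ln (x + l) - jensen_gap l (1 - p) (1 - l - x)" for x
  have pl: "p * l > 0" "1 - l + (1 - p) * l \<noteq> 0"
    using assms by (auto simp: add_pos_pos less_imp_neq[symmetric])
  have "isCont h 0"
    unfolding h_def jensen_gap_def
    by (intro isCont_diff isCont_mult isCont_ln' isCont_add continuous_const continuous_ident)
       (use assms pl in auto)
  then have h: "(h \<longlongrightarrow> h 0) (at_right 0)"
    by (simp add: isCont_def filterlim_at_split)
  have "filterlim (\<lambda>x. - ln x) at_top (at_right (0::real))"
    using ln_at_0 by (simp add: filterlim_uminus_at_bot)
  then have "filterlim (\<lambda>x. (1 - p) * - ln x) at_top (at_right (0::real))"
    by (rule filterlim_tendsto_pos_mult_at_top[OF tendsto_const, rotated]) (use assms in auto)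
  from filterlim_tendsto_add_at_top[OF h this]
  have "\<forall>\<^sub>F x in at_right 0. 0 < h x + (1 - p) * (- ln x)"
    unfolding filterlim_at_top_dense by blast
  moreover have "\<forall>\<^sub>F x::real in at_right 0. x \<in> {0<..<min c (1 - l)}"
    by (rule eventually_at_right_real) (use assms in auto)
  ultimately have "\<forall>\<^sub>F x in at_right 0. 0 < x \<and> x < c \<and> x < 1 - l \<and> jensen_gap l (1 - p) (1 - l - x) < jensen_gap l p x"
  proof eventually_elim
    case (elim x)
    have "jensen_gap l p x - jensen_gap l (1 - p) (1 - l - x) = h x + (1 - p) * (- ln x)"
      unfolding h_def jensen_gap_def[of l p] by simp
    with elim show ?case by auto
  qed
  then show ?thesis
    using eventually_happens'[OF trivial_limit_at_right_real] by blast
qed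

text \<open>For u in [0, 1], \<open>ln (1 + u)\<close> lies between u - u^2 and u; the hypothesis
  \<open>l \<le> x\<close> puts l / x into this range.\<close>

lemma jensen_gap_le:
  assumes "0 < p" "p < 1" "0 < l" "l \<le> x"
  shows "jensen_gap l p x \<le> p * l\<^sup>2 / x\<^sup>2"
proof -
  have x: "x > 0" "p * l > 0" using assms by auto
  have eq: "1 + p * l / x = (x + p * l) / x" "1 + l / x = (x + l) / x"
    using x by (simp_all add: field_simps)
  have "jensen_gap l p x = ln (1 + p * l / x) - p * ln (1 + l / x)"
  proof -
    have ln: "ln ((x + p * l) / x) = ln (x + p * l) - ln x" "ln ((x + l) / x) = ln (x + l) - ln x"
      using x assms by (auto intro!: ln_divide_pos add_pos_pos)
    show ?thesis unfolding jensen_gap_def eq ln by (simp add: algebra_simps)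
  qed
  also have "\<dots> \<le> p * l / x - p * (l / x - (l / x)\<^sup>2)"
  proof (rule diff_mono)
    show "ln (1 + p * l / x) \<le> p * l / x" using x by (intro ln_add_one_self_le_self) auto
    show "p * (l / x - (l / x)\<^sup>2) \<le> p * ln (1 + l / x)"
      using assms by (intro mult_left_mono ln_one_plus_pos_lower_bound) auto
  qed
  also have "\<dots> = p * l\<^sup>2 / x\<^sup>2"
    using x by (simp add: field_simps power2_eq_square)
  finally show ?thesis .
qed

text \<open>Take two Bernoulli laws with success probabilities a and a + l. The two gaps are the
  Jensen deficits of \<open>ln\<close> for their success and their failure probabilities; equality
  of the gaps is the stationarity condition of the saddle point. The intermediate value theorem
  applies along a + b = 1 - l, since each gap dominates at one end.\<close>

lemma jensen_gap_balanced:
  assumes pq: "0 < p" "0 < q" "p + q = 1" and l: "0 < l" "l < 1"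
  shows "\<exists>a b. a > 0 \<and> b > 0 \<and> a + b = 1 - l \<and> jensen_gap l p a = jensen_gap l q b
           \<and> (l < 1 / 4 \<longrightarrow> q * l / 2 \<le> b)"
proof -
  have q: "1 - p = q" "1 - q = p" using pq by auto
  \<comment> \<open>For l < 1/4 the left end is explicit, so that the root satisfies b >= q l / 2
    and the later shift q l / b is at most 2.\<close>
  define b1 where "b1 = (if l < 1 / 4 then q * l / 2 else
     (SOME x. x > 0 \<and> x < 1 \<and> x < 1 - l \<and> jensen_gap l p (1 - l - x) < jensen_gap l q x))"
  have ql: "q * l < l" using pq l by simp
  have b1: "b1 > 0 \<and> b1 < 1 - l \<and> jensen_gap l p (1 - l - b1) \<le> jensen_gap l q b1"
  proof (cases "l < 1 / 4")
    case True
    \<comment> \<open>Here the threshold 1/4 enters: 1 - 3 l / 2 >= 5 l / 2.\<close>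
    have x: "1 - l - q * l / 2 \<ge> 5 / 2 * l" "1 - l - q * l / 2 > 0" using True ql l by linarith+
    have "jensen_gap l p (1 - l - q * l / 2) \<le> p * l\<^sup>2 / (1 - l - q * l / 2)\<^sup>2"
      by (rule jensen_gap_le) (use pq l x in auto)
    also have "\<dots> \<le> p * l\<^sup>2 / (5 / 2 * l)\<^sup>2"
      using pq l x by (intro divide_left_mono mult_left_mono power_mono mult_pos_pos mult_nonneg_nonneg) auto
    also have "\<dots> = p * (4 / 25)" using l by (simp add: field_simps power2_eq_square)
    also have "\<dots> \<le> p * (ln 3 - 2 / 3)"
      using ln3_gt_1 pq by (intro mult_left_mono) auto
    also have "\<dots> \<le> ln 3 - q * ln (1 + 2 / q)"
    proof -
      \<comment> \<open>Tangent of \<open>ln\<close> at 3, the value of 1 + 2 / q at q = 1. The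
        resulting lower bound is therefore proportional to p, as is the upper bound on the other
        gap.\<close>
      have "ln ((1 + 2 / q) / 3) \<le> (1 + 2 / q) / 3 - 1" using pq by (intro ln_le_minus_one) (auto simp: add_pos_pos)
      moreover have "ln ((1 + 2 / q) / 3) = ln (1 + 2 / q) - ln 3"
        using pq by (intro ln_divide_pos) (auto simp: add_pos_pos)
      ultimately have "ln (1 + 2 / q) \<le> ln 3 + (2 / q - 2) / 3" by argo
      then have "q * ln (1 + 2 / q) \<le> q * (ln 3 + (2 / q - 2) / 3)"
        using pq by (intro mult_left_mono) auto
      also have "\<dots> = q * ln 3 + 2 / 3 * (1 - q)" using pq by (simp add: field_simps)
      finally show ?thesis unfolding q(2)[symmetric] by (simp add: algebra_simps)
    qed
    also have "\<dots> = jensen_gap l q (q * l / 2)"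
    proof -
      have "q * l / 2 + q * l = 3 * (q * l / 2)" "q * l / 2 + l = (1 + 2 / q) * (q * l / 2)"
        using pq by (simp_all add: field_simps)
      moreover have "1 + 2 / q > 0" "q * l / 2 > 0" using pq l by (simp_all add: add_pos_pos)
      ultimately show ?thesis
        unfolding jensen_gap_def by (simp only: ln_mult_pos) (simp add: ln_mult_pos algebra_simps)
    qed
    finally show ?thesis using True x pq l by (simp add: b1_def)
  next
    case False
    have "\<exists>x. x > 0 \<and> x < 1 \<and> x < 1 - l \<and> jensen_gap l p (1 - l - x) < jensen_gap l q x"
      using jensen_gap_eventually_greater[of q l 1] pq q l by auto
    from someI_ex[OF this] show ?thesis using False by (simp add: b1_def)
  qed
  obtain a2 where a2: "a2 > 0" "a2 < 1 - l - b1" "a2 < 1 - l" "jensen_gap l q (1 - l - a2) < jensen_gap l p a2"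
    using jensen_gap_eventually_greater[of p l "1 - l - b1"] pq q l b1 by auto
  have "\<exists>b. b1 \<le> b \<and> b \<le> 1 - l - a2 \<and> jensen_gap l q b - jensen_gap l p (1 - l - b) = 0"
  proof (rule IVT2')
    show "continuous_on {b1..1 - l - a2} (\<lambda>b. jensen_gap l q b - jensen_gap l p (1 - l - b))"
    proof (intro continuous_at_imp_continuous_on ballI)
      fix x assume "x \<in> {b1..1 - l - a2}"
      then have "x > 0" "1 - l - x > 0" using b1 a2 by auto
      moreover have "p * l > 0" "q * l > 0" using pq l by auto
      ultimately have "x + q * l \<noteq> 0" "x + l \<noteq> 0" "x \<noteq> 0" "1 - l - x + p * l \<noteq> 0"
        "1 - l - x + l \<noteq> 0" "1 - l - x \<noteq> 0" using l by linarith+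
      then show "isCont (\<lambda>b. jensen_gap l q b - jensen_gap l p (1 - l - b)) x"
        unfolding jensen_gap_def
        by (intro isCont_diff isCont_mult isCont_ln' isCont_add continuous_const continuous_ident)
    qed
  qed (use b1 a2 in auto)
  then obtain b where b: "b1 \<le> b" "b \<le> 1 - l - a2" "jensen_gap l q b = jensen_gap l p (1 - l - b)" by auto
  then show ?thesis
    using b1 a2 by (intro exI[of _ "1 - l - b"] exI[of _ b]) (auto simp: b1_def)
qed

text \<open>In units of N = n + 1 + m, the shift y is N e and x stands for A / (n + 1); the last
  bracket is the contribution of the end point of the path. By \<open>tilted_rate_min\<close> only
  the stationary point a matters, and there the expression equals the Jensen--Shannon divergence
  with s = a + p l.\<close>

lemma exists_tilt_rate_ge:
  fixes p q l :: real
  assumes pq: "p > 0" "q > 0" "p + q = 1" and l: "l > 0" "l < 1"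
  shows "\<exists>e>0. (l < 1 / 4 \<longrightarrow> e \<le> 2) \<and> (\<forall>x>0.
     xlnx (x + p * l + e) + xlnx (q * x) - xlnx (x + p * l) - xlnx (q * x + e)
     - (xlnx (1 + e) + xlnx q - xlnx (q + e)) \<ge> 2 * p * q * l\<^sup>2)"
proof -
  obtain a b where ab: "a > 0" "b > 0" "a + b = 1 - l" and gap: "jensen_gap l p a = jensen_gap l q b"
    and b_ge: "l < 1 / 4 \<longrightarrow> q * l / 2 \<le> b"
    using jensen_gap_balanced[OF pq l] by blast
  \<comment> \<open>This value gives both shifted arguments the factor a + l: a + p l + e = (a + l)
    (1 + e) and q a + e = (a + l) (q + e). Stationarity at a then reduces to equality of the two
    gaps.\<close>
  define e where "e = q * l / b"
  have e: "e > 0" using pq l ab by (simp add: e_def)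
  have be: "b * e = q * l" using ab by (simp add: e_def)
  have q1: "1 - p = q" "1 - q = p" and k: "1 - b = a + l" using pq ab by auto
  have pos: "a + l > 0" "a + p * l > 0" "b + l > 0" "b + q * l > 0" "1 + e > 0" "q + e > 0"
    "p * l > 0" "q * l > 0"
    using ab l pq e by (auto intro!: add_pos_pos)
  have shift1: "a + p * l + e = (a + l) * (1 + e)"
  proof -
    have "(a + l) * (1 + e) = (a + l) + (1 - b) * e" unfolding k by (simp add: algebra_simps)
    also have "\<dots> = a + l + e - q * l" using be by (simp add: algebra_simps)
    also have "\<dots> = a + p * l + e" unfolding q1(2)[symmetric] by (simp add: algebra_simps)
    finally show ?thesis ..
  qed
  have shift2: "q * a + e = (a + l) * (q + e)"
  proof -
    have "(a + l) * (q + e) = (a + l) * q + (1 - b) * e" unfolding k by (simp add: algebra_simps)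
    also have "\<dots> = q * a + e" using be by (simp add: algebra_simps)
    finally show ?thesis ..
  qed
  have end1: "1 + e = (b + q * l) / b" and end2: "q + e = q * (b + l) / b"
    using ab by (simp_all add: e_def field_simps)
  have lend: "ln (1 + e) = ln (b + q * l) - ln b" "ln (q + e) = ln q + ln (b + l) - ln b"
    unfolding end1 end2 using pos ab pq by (simp_all add: ln_divide_pos ln_mult_pos)
  have lnshift: "ln (a + p * l + e) = ln (a + l) + ln (1 + e)" "ln (q * a + e) = ln (a + l) + ln (q + e)"
    "ln (q * a) = ln q + ln a"
    unfolding shift1 shift2 using pos pq ab by (simp_all add: ln_mult_pos)
  have stat: "ln (a + p * l + e) + q * ln (q * a) - ln (a + p * l) - q * ln (q * a + e) = 0"
  proof -
    have "ln (a + p * l + e) + q * ln (q * a) - ln (a + p * l) - q * ln (q * a + e)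
       = (ln (b + q * l) - (1 - q) * ln b - q * ln (b + l)) - (ln (a + p * l) - q * ln a - (1 - q) * ln (a + l))"
      unfolding lnshift lend by (simp add: algebra_simps)
    also have "\<dots> = 0" using gap by (simp add: jensen_gap_def q1)
    finally show ?thesis .
  qed
  have val: "2 * p * q * l\<^sup>2 \<le>
     xlnx (a + p * l + e) + xlnx (q * a) - xlnx (a + p * l) - xlnx (q * a + e)
     - (xlnx (1 + e) + xlnx q - xlnx (q + e))"
  proof -
    define s where "s = a + p * l"
    have s: "s + q * l = a + l" "s - p * l = a" "1 - s + p * l = b + l" "1 - s - q * l = b" "1 - s = b + q * l"
    proof -
      show "s + q * l = a + l" unfolding s_def q1(2)[symmetric] by (simp add: algebra_simps)
      then show "1 - s - q * l = b" using ab by simp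
      then show "1 - s = b + q * l" by simp
      show "s - p * l = a" "1 - s + p * l = b + l" using ab by (auto simp: s_def)
    qed
    have "2 * p * q * l\<^sup>2 \<le> p * xlnx (s + q * l) + q * xlnx (s - p * l) - xlnx s
       + (q * xlnx (1 - s + p * l) + p * xlnx (1 - s - q * l) - xlnx (1 - s))"
    proof (rule jensen_shannon_ge)
      show "s - p * l > 0" "s + q * l < 1" using s(1,2) ab by linarith+
    qed (use pq l in auto)
    also have "\<dots> = p * xlnx (a + l) + q * xlnx a - xlnx (a + p * l)
       + (q * xlnx (b + l) + p * xlnx b - xlnx (b + q * l))"
      unfolding s(1-4) unfolding s(5) unfolding s_def ..
    also have "\<dots> = xlnx (a + p * l + e) + xlnx (q * a) - xlnx (a + p * l) - xlnx (q * a + e)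
     - (xlnx (1 + e) + xlnx q - xlnx (q + e))"
    proof -
      have X: "xlnx (a + p * l + e) = (a + l) * xlnx (1 + e) + (1 + e) * xlnx (a + l)"
        "xlnx (q * a + e) = (a + l) * xlnx (q + e) + (q + e) * xlnx (a + l)"
        unfolding shift1 shift2 using pos by (simp_all add: xlnx_mult)
      have Y: "b * xlnx (1 + e) = (b + q * l) * (ln (b + q * l) - ln b)"
        "b * xlnx (q + e) = q * (b + l) * (ln q + ln (b + l) - ln b)"
        unfolding xlnx_def lend unfolding end1 end2 using ab by simp_all
      have "xlnx (a + p * l + e) - xlnx (q * a + e) - xlnx (1 + e) + xlnx (q + e)
         = (a + l - 1) * xlnx (1 + e) - (a + l - 1) * xlnx (q + e) + (1 - q) * xlnx (a + l)"
        unfolding X by (simp add: algebra_simps)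
      also have "\<dots> = b * xlnx (q + e) - b * xlnx (1 + e) + p * xlnx (a + l)"
      proof -
        have "a + l - 1 = - b" using ab by simp
        then show ?thesis using q1 by simp
      qed
      also have "\<dots> = q * (b + l) * ln q + q * xlnx (b + l) - xlnx (b + q * l) + (1 - q) * b * ln b + p * xlnx (a + l)"
        unfolding Y unfolding xlnx_def by (simp add: algebra_simps)
      finally have "xlnx (a + p * l + e) - xlnx (q * a + e) - xlnx (1 + e) + xlnx (q + e) = 
        q * (b + l) * ln q + q * xlnx (b + l) - xlnx (b + q * l) + p * xlnx b + p * xlnx (a + l)"
        by (simp add: q1 xlnx_def)
      moreover have "xlnx (q * a) = q * xlnx a + q * a * ln q"
        using pq ab by (simp add: xlnx_mult) (simp add: xlnx_def)
      moreover have "q * (b + l) * ln q + q * a * ln q = xlnx q"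
      proof -
        have "q * (b + l) * ln q + q * a * ln q = q * (a + b + l) * ln q" by (simp add: algebra_simps)
        then show ?thesis using ab by (simp add: xlnx_def)
      qed
      ultimately show ?thesis by linarith
    qed
    finally show ?thesis .
  qed
  have e2: "e \<le> 2" if "l < 1 / 4"
    using that b_ge ab by (simp add: e_def field_simps)
  show ?thesis
  proof (intro exI[of _ e] conjI impI allI)
    fix x :: real assume "x > 0"
    with val tilted_rate_min[OF pq l(1) e ab(1) stat this] show
      "2 * p * q * l\<^sup>2 \<le> xlnx (x + p * l + e) + xlnx (q * x) - xlnx (x + p * l) - xlnx (q * x + e)
        - (xlnx (1 + e) + xlnx q - xlnx (q + e))" by linarith
  qed (use e e2 in auto)
qed

subsection \<open>From integrals to sums\<close>

text \<open>Up to the additive constant \<open>1\<close>, the error of the trapezoidal rule for the integral of \<open>ln\<close>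
  over \<open>{z..z + 1}\<close>.\<close>

definition trapezoid_defect :: "real \<Rightarrow> real" where
  "trapezoid_defect z = (z + 1 / 2) * (ln (z + 1) - ln z)"

lemma trapezoid_defect_deriv:
  assumes "z > 0"
  shows "(trapezoid_defect has_real_derivative ln (z + 1) - ln z - (1 / z + 1 / (z + 1)) / 2) (at z)"
proof -
  have "(trapezoid_defect has_real_derivative
      (1 + 0) * (ln (z + 1) - ln z) + (1 / (z + 1) - 1 / z) * (z + 1 / 2)) (at z)"
    unfolding trapezoid_defect_def using assms
    by (intro DERIV_mult DERIV_diff DERIV_add DERIV_ident DERIV_const) (auto intro!: derivative_eq_intros)
  moreover have eq: "(1 / (z + 1) - 1 / z) * (z + 1 / 2) = - ((1 / z + 1 / (z + 1)) / 2)"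
    using assms by (simp add: divide_simps)
  ultimately show ?thesis unfolding eq by simp
qed

text \<open>The derivative is the integral of 1 / t over [z, z + 1] minus its trapezoidal value,
  which is at most 0 because 1 / t is convex.\<close>

lemma trapezoid_defect_antimono:
  assumes "0 < z" "z \<le> w"
  shows "trapezoid_defect w \<le> trapezoid_defect z"
proof (rule DERIV_nonpos_imp_nonincreasing[OF assms(2)])
  fix x assume x: "z \<le> x" "x \<le> w"
  with assms have "x > 0" by simp
  with ln_inverse_approx_le[of x 1] trapezoid_defect_deriv[of x]
  show "\<exists>y. (trapezoid_defect has_real_derivative y) (at x) \<and> y \<le> 0"
    by (intro exI[of _ "ln (x + 1) - ln x - (1 / x + 1 / (x + 1)) / 2"]) (auto simp: inverse_eq_divide)
qed

text \<open>Bounding the logarithm in the derivative by the midpoint rule shows that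
  \<open>f\<close> increases. The factor 1/8 is the Euler--Maclaurin coefficient 1/12 plus the 1/24
  lost by the midpoint rule. The form of the bound telescopes in sums.\<close>

lemma trapezoid_defect_diff_le:
  assumes "0 < z" "z \<le> w"
  shows "trapezoid_defect z - trapezoid_defect w
       \<le> ((1 / z - 1 / (z + 1)) - (1 / w - 1 / (w + 1))) / 8"
proof -
  define f where "f x = trapezoid_defect x - (1 / x - 1 / (x + 1)) / 8" for x
  have "f z \<le> f w"
  proof (rule DERIV_nonneg_imp_nondecreasing[OF assms(2)])
    fix x assume x: "z \<le> x" "x \<le> w"
    with assms have x0: "x > 0" by simp
    have D: "(f has_real_derivative ln (x + 1) - ln x - (1 / x + 1 / (x + 1)) / 2
        - (- 1 / x\<^sup>2 - - 1 / (x + 1)\<^sup>2) / 8) (at x)"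
      unfolding f_def using x0
      by (intro DERIV_diff trapezoid_defect_deriv DERIV_cdivide)
         (auto intro!: derivative_eq_intros simp: power2_eq_square)
    have "ln (x + 1) - ln x \<ge> 2 / (2 * x + 1)"
      using ln_inverse_approx_ge[of x "x + 1"] x0 by (simp add: add_ac)
    moreover have "2 / (2 * x + 1) - (1 / x + 1 / (x + 1)) / 2 - (- 1 / x\<^sup>2 - - 1 / (x + 1)\<^sup>2) / 8
       = 1 / (8 * x\<^sup>2 * (x + 1)\<^sup>2 * (2 * x + 1))"
      using x0 by (simp add: divide_simps) (simp add: algebra_simps power2_eq_square)
    moreover have "1 / (8 * x\<^sup>2 * (x + 1)\<^sup>2 * (2 * x + 1)) \<ge> 0" using x0 by simp
    ultimately have "0 \<le> ln (x + 1) - ln x - (1 / x + 1 / (x + 1)) / 2 - (- 1 / x\<^sup>2 - - 1 / (x + 1)\<^sup>2) / 8"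
      by linarith
    with D show "\<exists>y. (f has_real_derivative y) (at x) \<and> 0 \<le> y" by blast
  qed
  then show ?thesis by (simp add: f_def diff_divide_distrib)
qed

text \<open>Trapezoidal summation of \<open>ln\<close> at the points x + j + y and x + j: the
  integrals telescope to \<open>xlnx\<close>, the end weights give the halved terms, and the defects
  remain.\<close>

lemma sum_ln_ratio_eq:
  fixes x y :: real
  shows "(\<Sum>j<k. ln (x + real j + y) - ln (x + real j)) =
     (xlnx (x + real k + y) - xlnx (x + real k)) - (xlnx (x + y) - xlnx x)
     + ((ln (x + y) - ln x) - (ln (x + real k + y) - ln (x + real k))) / 2
     + (\<Sum>j<k. trapezoid_defect (x + real j) - trapezoid_defect (x + real j + y))"
proof (induction k)
  case (Suc k)
  have step: "trapezoid_defect z = xlnx (z + 1) - xlnx z - (ln z + ln (z + 1)) / 2" for z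
    by (simp add: trapezoid_defect_def xlnx_def field_simps)
  show ?case
    using Suc by (simp add: step add_ac field_simps)
qed simp

text \<open>Meant for the crossing point: the defects are dropped by monotonicity, so no error term
  depends on that point.\<close>

lemma sum_ln_ratio_ge:
  fixes x y :: real
  assumes "x > 0" "y \<ge> 0"
  shows "(xlnx (x + real k + y) - xlnx (x + real k)) - (xlnx (x + y) - xlnx x)
     + ((ln (x + y) - ln x) - (ln (x + real k + y) - ln (x + real k))) / 2
     \<le> (\<Sum>j<k. ln (x + real j + y) - ln (x + real j))"
proof -
  have "(\<Sum>j<k. trapezoid_defect (x + real j) - trapezoid_defect (x + real j + y)) \<ge> 0"
    using assms by (intro sum_nonneg) (auto intro!: trapezoid_defect_antimono)
  then show ?thesis unfolding sum_ln_ratio_eq by simp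
qed

text \<open>Meant for the end point of the path, where the defects telescope to a mixed second
  difference of 1 / x.\<close>

lemma sum_ln_ratio_le:
  fixes x y :: real
  assumes "x > 0" "y \<ge> 0"
  shows "(\<Sum>j<k. ln (x + real j + y) - ln (x + real j))
     \<le> (xlnx (x + real k + y) - xlnx (x + real k)) - (xlnx (x + y) - xlnx x)
     + ((ln (x + y) - ln x) - (ln (x + real k + y) - ln (x + real k))) / 2
     + (1 / x - 1 / (x + real k) - (1 / (x + y) - 1 / (x + real k + y))) / 8"
proof -
  have "(\<Sum>j<k. trapezoid_defect (x + real j) - trapezoid_defect (x + real j + y)) \<le>
     (1 / x - 1 / (x + real k) - (1 / (x + y) - 1 / (x + real k + y))) / 8"
  proof (induction k)
    case (Suc k)
    have "trapezoid_defect (x + real k) - trapezoid_defect (x + real k + y)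
      \<le> ((1 / (x + real k) - 1 / (x + real k + 1)) - (1 / (x + real k + y) - 1 / (x + real k + y + 1))) / 8"
      using assms by (intro trapezoid_defect_diff_le) auto
    with Suc show ?case by (simp add: add_ac diff_divide_distrib)
  qed simp
  then show ?thesis unfolding sum_ln_ratio_eq by simp
qed

text \<open>The boundary terms are larger at a crossing point than at the end point, and half of
  this surplus is to pay for the trapezoidal error. Lowering B to the ray from the origin through
  (K, m) cancels the unshifted logarithms and leaves ln X - ln Y >= (X - Y) / X; the distance K - A
  >= 1 bounds X - Y from below.\<close>

lemma ln_ratio_gain:
  fixes A B K m y :: real
  assumes "0 < A" "A + 1 \<le> K" "0 < m" "m * A \<le> B * K" "0 < y"
  shows "m * y / (K * (K + y) * (K + m + y))
    \<le> ((ln (A + y) - ln A) - (ln (A + B + y) - ln (A + B))) - ((ln (K + y) - ln K) - (ln (K + m + y) - ln (K + m)))"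
proof -
  define c where "c = m / K"
  have K: "K > 0" using assms by simp
  have c: "c > 0" using assms K by (simp add: c_def)
  have cK: "c * K = m" using K by (simp add: c_def)
  have Bc: "c * A \<le> B" using assms K by (simp add: c_def field_simps)
  have cA: "c * A > 0" using c assms by simp
  have mono: "ln (A + B + y) - ln (A + B) \<le> ln (A + c * A + y) - ln (A + c * A)"
  proof -
    have p: "A + c * A > 0" "A + B > 0" "A + c * A + y > 0" "A + B + y > 0" using assms cA Bc by linarith+
    have "(A + B + y) * (A + c * A) \<le> (A + c * A + y) * (A + B)"
      using mult_left_mono[OF Bc, of y] assms by (simp add: algebra_simps)
    then have "ln ((A + B + y) * (A + c * A)) \<le> ln ((A + c * A + y) * (A + B))"
      using p by (subst ln_le_cancel_iff) auto
    then show ?thesis using p by (simp add: ln_mult_pos)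
  qed
  define X where "X = (A + y) * (K + m + y)"
  define Y where "Y = (A + c * A + y) * (K + y)"
  have p: "A + y > 0" "K + m + y > 0" "A + c * A + y > 0" "K + y > 0" using assms cA by linarith+
  have XY: "X > 0" "Y > 0" using p by (auto simp: X_def Y_def)
  have "X - Y = c * y * (K - A)"
    unfolding X_def Y_def cK[symmetric] by (simp add: algebra_simps)
  then have "c * y \<le> X - Y"
    using mult_left_mono[of 1 "K - A" "c * y"] assms c by simp
  have "m * y / (K * (K + y) * (K + m + y)) = c * y / ((K + y) * (K + m + y))"
    using K by (simp add: c_def field_simps)
  also have "\<dots> \<le> c * y / X"
    using assms p c unfolding X_def by (intro divide_left_mono mult_right_mono mult_pos_pos) auto
  also have "\<dots> \<le> (X - Y) / X"
    using \<open>c * y \<le> X - Y\<close> XY by (intro divide_right_mono) auto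
  also have "\<dots> \<le> ln X - ln Y"
  proof -
    have "ln (Y / X) \<le> Y / X - 1" using XY by (intro ln_le_minus_one) auto
    then show ?thesis using XY by (simp add: ln_divide_pos diff_divide_distrib)
  qed
  also have "ln X - ln Y = ((ln (A + y) - ln A) - (ln (A + c * A + y) - ln (A + c * A)))
      - ((ln (K + y) - ln K) - (ln (K + m + y) - ln (K + m)))"
  proof -
    have "A + c * A = A * (1 + c)" "K + m = K * (1 + c)" by (simp_all add: algebra_simps flip: cK)
    then have "ln (A + c * A) = ln A + ln (1 + c)" "ln (K + m) = ln K + ln (1 + c)"
      using assms K c by (simp_all add: ln_mult_pos)
    then show ?thesis unfolding X_def Y_def using p by (simp add: ln_mult_pos)
  qed
  also have "\<dots> \<le> ((ln (A + y) - ln A) - (ln (A + B + y) - ln (A + B))) - ((ln (K + y) - ln K) - (ln (K + m + y) - ln (K + m)))"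
    using mono by simp
  finally show ?thesis .
qed

text \<open>Over a common denominator the second difference is \<open>P\<close> times (2 K + m + y)
  / (K + m), and the bound on y keeps this quotient below 4.\<close>

lemma trapezoid_error_le:
  fixes K m y :: real
  assumes "0 < K" "0 < m" "0 < y" "y \<le> 2 * (K + m)"
  shows "(1 / K - 1 / (K + m) - (1 / (K + y) - 1 / (K + m + y))) / 8
     \<le> m * y / (K * (K + y) * (K + m + y)) / 2"
proof -
  define P where "P = m * y / (K * (K + y) * (K + m + y))"
  have P: "P \<ge> 0" using assms by (simp add: P_def)
  have s: "K + m > 0" "K + y > 0" "K + m + y > 0" using assms by auto
  have eq: "1 / K - 1 / (K + m) - (1 / (K + y) - 1 / (K + m + y)) = P * ((2 * K + m + y) / (K + m))"
    unfolding P_def using assms(1) s by (simp add: divide_simps) (simp add: algebra_simps)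
  have "P * ((2 * K + m + y) / (K + m)) \<le> P * 4"
    using assms P by (intro mult_left_mono) (auto simp: divide_simps)
  from divide_right_mono[OF this, of 8] show ?thesis unfolding eq P_def[symmetric] by simp
qed

section \<open>From the scaled rate to lattice points\<close>

lemma xlnx_scale_rate:
  fixes N x e v :: real
  assumes "N > 0" "x > 0" "v > 0" "e > 0"
  shows "(xlnx (N * x + N * e) - xlnx (N * x)) - (xlnx (N * v + N * e) - xlnx (N * v))
     = N * (xlnx (x + e) + xlnx v - xlnx x - xlnx (v + e))"
proof -
  \<comment> \<open>The terms in \<open>xlnx N\<close> cancel in the end, because (x + e) + v = x +
    (v + e).\<close>
  have "xlnx (N * z) = N * xlnx z + z * xlnx N" if "z > 0" for z
    using that assms by (simp add: xlnx_mult)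
  from this[of x] this[of v] this[of "x + e"] this[of "v + e"] show ?thesis
    using assms by (simp add: distrib_left[symmetric]) (simp add: algebra_simps)
qed

text \<open>Convexity of \<open>xlnx\<close>. It allows passing from the real height of the boundary
  to an integer b above it.\<close>

lemma xlnx_shift_mono:
  fixes x x' y :: real
  assumes "0 < x" "x \<le> x'" "0 \<le> y"
  shows "xlnx (x + y) - xlnx x \<le> xlnx (x' + y) - xlnx x'"
proof (rule DERIV_nonneg_imp_nondecreasing[OF assms(2)])
  fix t assume t: "x \<le> t" "t \<le> x'"
  then have "((\<lambda>x. xlnx (x + y) - xlnx x) has_real_derivative 1 * (ln (t + y) + 1) - 1 * (ln t + 1)) (at t)"
    using assms by (intro DERIV_diff xlnx_deriv) (auto intro!: derivative_eq_intros)
  moreover have "ln t \<le> ln (t + y)" using t assms by simp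
  ultimately show "\<exists>d. ((\<lambda>x. xlnx (x + y) - xlnx x) has_real_derivative d) (at t) \<and> 0 \<le> d"
    by force
qed

text \<open>After exponentiation: one y makes the likelihood ratio at least exp (2 tau lam^2) at
  every lattice point beyond the boundary. A stands for a + 1, the offset carried by both the
  p-values and the products; this is why K = n + 1 appears.\<close>

lemma exists_tilt:
  fixes n m :: nat and lam :: real
  assumes "n \<ge> 1" "m \<ge> 1" and lam: "0 < lam" "lam < 1"
  shows "\<exists>y>0. \<forall>A b. 0 < A \<longrightarrow> b \<le> m \<longrightarrow> lam + real A / (real n + 1) < real b / real m \<longrightarrow>
     2 * tau n m * lam\<^sup>2 + (\<Sum>j<m. ln (real n + 1 + real j + y) - ln (real n + 1 + real j))
     \<le> (\<Sum>j<b. ln (real A + real j + y) - ln (real A + real j))"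
proof -
  define K where "K = real n + 1"
  define M where "M = real m"
  have K: "K \<ge> 2" and M: "M \<ge> 1" using assms by (auto simp: K_def M_def)
  define N where "N = K + M"
  define p where "p = M / N"
  define q where "q = K / N"
  have N: "N > 0" using K M by (simp add: N_def)
  have pq: "p > 0" "q > 0" "p + q = 1"
    using K M N by (auto simp: p_def q_def N_def simp flip: add_divide_distrib)
  have NpM: "N * p = M" "N * q = K" using N by (auto simp: p_def q_def)
  obtain e where e: "e > 0" "lam < 1 / 4 \<Longrightarrow> e \<le> 2" and rate: "\<And>x. x > 0 \<Longrightarrow>
     2 * p * q * lam\<^sup>2 \<le> xlnx (x + p * lam + e) + xlnx (q * x) - xlnx (x + p * lam) - xlnx (q * x + e)
     - (xlnx (1 + e) + xlnx q - xlnx (q + e))"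
    using exists_tilt_rate_ge[OF pq lam] by blast
  define y where "y = N * e"
  have y: "y > 0" using N e by (simp add: y_def)
  define err where "err = (1 / K - 1 / (K + M) - (1 / (K + y) - 1 / (K + M + y))) / 8"
  define gain where "gain = M * y / (K * (K + y) * (K + M + y))"
  \<comment> \<open>The error budget. For lam < 1/4, e <= 2 and \<open>gain / 2\<close> covers
    \<open>err\<close>. Otherwise 2 lam^2 >= 1/8, and the difference of K M / N and
    \<open>tau n m\<close>, multiplied by 2 lam^2, covers it.\<close>
  have tau_le: "2 * tau n m * lam\<^sup>2 + err \<le> 2 * (K * M / N) * lam\<^sup>2 + gain / 2"
  proof (cases "lam < 1 / 4")
    case True
    then have "y \<le> 2 * (K + M)" using mult_left_mono[of e 2 N] e(2) N by (simp add: y_def N_def mult.commute)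
    then have "err \<le> gain / 2"
      unfolding err_def gain_def using K M y by (intro trapezoid_error_le) auto
    moreover have "tau n m \<le> K * M / N"
      unfolding tau_def K_def M_def N_def using assms
      by (simp add: divide_simps) (simp add: algebra_simps)
    then have "2 * tau n m * lam\<^sup>2 \<le> 2 * (K * M / N) * lam\<^sup>2"
      by (intro mult_right_mono) auto
    ultimately show ?thesis by linarith
  next
    case False
    have "1 / (K + y) - 1 / (K + M + y) \<ge> 0" using K M y by (simp add: frac_le)
    then have "err \<le> (1 / K - 1 / (K + M)) / 8" by (simp add: err_def)
    also have "\<dots> \<le> (K * M / N - tau n m) / 8"
    proof -
      have "real n * 1 \<le> real n * real m" using assms by (intro mult_left_mono) auto
      then have le: "real n + M \<le> M * K" by (simp add: M_def K_def algebra_simps)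
      have pos: "real n + M > 0" using M by simp
      have "1 / K - 1 / (K + M) = M / (K * N)" using K M by (simp add: N_def field_simps)
      also have "\<dots> \<le> M\<^sup>2 / ((real n + M) * N)"
      proof -
        have eq: "M / (K * N) = (M / N) * (1 / K)" "M\<^sup>2 / ((real n + M) * N) = (M / N) * (M / (real n + M))"
          by (simp_all add: power2_eq_square)
        have "1 / K \<le> M / (real n + M)" using le pos K by (simp add: divide_simps)
        then show ?thesis unfolding eq using M N by (intro mult_left_mono) auto
      qed
      also have "\<dots> = K * M / N - tau n m"
      proof -
        have "tau n m = real n * M / (real n + M)" by (simp add: tau_def M_def)
        moreover have "N = real n + M + 1" "K = real n + 1" by (auto simp: N_def K_def)
        ultimately show ?thesis
          using pos by (simp add: divide_simps power2_eq_square) (simp add: algebra_simps)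
      qed
      finally show ?thesis by (rule divide_right_mono) simp
    qed
    also have "\<dots> = 2 * (1 / 4)\<^sup>2 * (K * M / N - tau n m)" by (simp add: power2_eq_square)
    also have "\<dots> \<le> 2 * lam\<^sup>2 * (K * M / N - tau n m)"
    proof (intro mult_right_mono mult_left_mono power_mono)
      show "0 \<le> K * M / N - tau n m"
        unfolding tau_def K_def M_def N_def using assms
        by (simp add: divide_simps) (simp add: algebra_simps)
    qed (use False in auto)
    finally have "err \<le> 2 * (K * M / N) * lam\<^sup>2 - 2 * tau n m * lam\<^sup>2" by (simp add: algebra_simps)
    moreover have "gain \<ge> 0" using K M y by (simp add: gain_def)
    ultimately show ?thesis by linarith
  qed
  have upper: "(\<Sum>j<m. ln (K + real j + y) - ln (K + real j))
     \<le> (xlnx (K + M + y) - xlnx (K + M)) - (xlnx (K + y) - xlnx K)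
     + ((ln (K + y) - ln K) - (ln (K + M + y) - ln (K + M))) / 2 + err"
    unfolding err_def M_def using K y by (intro sum_ln_ratio_le) auto
  have "2 * tau n m * lam\<^sup>2 + (\<Sum>j<m. ln (K + real j + y) - ln (K + real j))
     \<le> (\<Sum>j<b. ln (real A + real j + y) - ln (real A + real j))"
    if A: "0 < A" and b: "b \<le> m" and cross: "lam + real A / K < real b / M" for A b
  proof -
    define x where "x = real A / K"
    have x: "x > 0" using A K by (simp add: x_def)
    \<comment> \<open>The real height of the boundary over A. Dividing (A, A + B) by N gives the
      arguments q x and x + p lam of the rate.\<close>
    define B where "B = M * (lam + x)"
    have B: "B < real b" using cross M by (simp add: B_def x_def field_simps)
    have "real b / M \<le> 1" using b M by (simp add: M_def)
    then have "real A / K < 1" using cross lam by linarith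
    then have "real A < real n + 1" using K by (simp add: K_def)
    then have AK: "real A + 1 \<le> K" by (simp add: K_def)
    have A_eq: "real A = N * (q * x)" "K * x = real A" using NpM K by (auto simp: x_def mult.assoc[symmetric])
    have AB: "real A + B = N * (x + p * lam)"
    proof -
      have "N * (x + p * lam) = (K + M) * x + M * lam" using NpM by (simp add: N_def distrib_left mult.assoc[symmetric])
      then show ?thesis using A_eq(2) by (simp add: B_def algebra_simps)
    qed
    have qx: "q * x > 0" and xp: "x + p * lam > 0" using pq x lam by (auto simp: add_pos_pos)
    have rate_scaled: "2 * (K * M / N) * lam\<^sup>2 \<le> (xlnx (real A + real b + y) - xlnx (real A + real b)) - (xlnx (real A + y) - xlnx (real A))
       - ((xlnx (K + M + y) - xlnx (K + M)) - (xlnx (K + y) - xlnx K))"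
    proof -
      have "2 * (K * M / N) * lam\<^sup>2 = N * (2 * p * q * lam\<^sup>2)" using N by (simp add: p_def q_def)
      also have "\<dots> \<le> N * (xlnx (x + p * lam + e) + xlnx (q * x) - xlnx (x + p * lam) - xlnx (q * x + e)
         - (xlnx (1 + e) + xlnx q - xlnx 1 - xlnx (q + e)))"
        using rate[OF x] N by (intro mult_left_mono) (auto simp: xlnx_def)
      also have "\<dots> = ((xlnx (real A + B + y) - xlnx (real A + B)) - (xlnx (real A + y) - xlnx (real A)))
         - ((xlnx (K + M + y) - xlnx (K + M)) - (xlnx (K + y) - xlnx K))"
      proof -
        have "(xlnx (real A + B + y) - xlnx (real A + B)) - (xlnx (real A + y) - xlnx (real A))
           = N * (xlnx (x + p * lam + e) + xlnx (q * x) - xlnx (x + p * lam) - xlnx (q * x + e))"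
          using xlnx_scale_rate[OF N xp qx e(1)] unfolding AB unfolding A_eq(1) y_def by simp
        moreover have "(xlnx (K + M + y) - xlnx (K + M)) - (xlnx (K + y) - xlnx K)
           = N * (xlnx (1 + e) + xlnx q - xlnx 1 - xlnx (q + e))"
          using xlnx_scale_rate[OF N zero_less_one pq(2) e(1)] NpM(2) unfolding y_def by (simp add: N_def)
        ultimately show ?thesis by (simp only: right_diff_distrib[symmetric])
      qed
      also have "\<dots> \<le> ((xlnx (real A + real b + y) - xlnx (real A + real b)) - (xlnx (real A + y) - xlnx (real A)))
         - ((xlnx (K + M + y) - xlnx (K + M)) - (xlnx (K + y) - xlnx K))"
        using xlnx_shift_mono[of "real A + B" "real A + real b" y] B y AB N xp by simp
      finally show ?thesis .
    qed
    have g: "gain \<le> ((ln (real A + y) - ln (real A)) - (ln (real A + real b + y) - ln (real A + real b)))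
        - ((ln (K + y) - ln K) - (ln (K + M + y) - ln (K + M)))"
      unfolding gain_def
    proof (rule ln_ratio_gain)
      have "M * real A = (M * x) * K" using A_eq(2) by (simp add: mult_ac)
      also have "\<dots> \<le> B * K" using M lam K by (intro mult_right_mono) (auto simp: B_def distrib_left)
      also have "\<dots> \<le> real b * K" using B K by (intro mult_right_mono) auto
      finally show "M * real A \<le> real b * K" .
    qed (use A AK M y in auto)
    have lower: "(xlnx (real A + real b + y) - xlnx (real A + real b)) - (xlnx (real A + y) - xlnx (real A))
     + ((ln (real A + y) - ln (real A)) - (ln (real A + real b + y) - ln (real A + real b))) / 2
     \<le> (\<Sum>j<b. ln (real A + real j + y) - ln (real A + real j))"
      using A y by (intro sum_ln_ratio_ge) auto
    show ?thesis using lower g rate_scaled upper tau_le by argo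
  qed
  then show ?thesis using y unfolding K_def M_def by blast
qed

subsection \<open>Counting crossing paths\<close>

text \<open>\<open>K\<close> marks the steps in the first coordinate. The two cardinalities are the
  coordinates of the lattice point reached when the scores, read in decreasing order, have been read
  down to \<open>x i\<close>.\<close>

definition crosses :: "(nat \<Rightarrow> nat \<Rightarrow> bool) \<Rightarrow> ('i \<Rightarrow> real) \<Rightarrow> 'i set \<Rightarrow> 'i set \<Rightarrow> bool" where
  "crosses P x I K \<longleftrightarrow> (\<exists>i\<in>I. P (card {k\<in>K. x i \<le> x k}) (card {k\<in>I - K. x i \<le> x k}))"

text \<open>Removing the smallest element is the last step of a lattice path, so the number of crossing
  paths is dominated by any \<open>H\<close> that satisfies Pascal's inequality and exceeds the number of all
  paths wherever \<open>P\<close> holds.\<close>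

lemma card_crosses_le:
  fixes x :: "'i \<Rightarrow> real" and H :: "nat \<Rightarrow> nat \<Rightarrow> real"
  assumes "finite I" "inj_on x I" "a \<le> card I"
    and nonneg: "\<And>a b. 0 \<le> H a b"
    and pascal: "\<And>a b. H a (Suc b) + H (Suc a) b \<le> H (Suc a) (Suc b)"
    and left: "\<And>a. H a 0 \<le> H (Suc a) 0" and right: "\<And>b. H 0 b \<le> H 0 (Suc b)"
    and bound: "\<And>a b. P a b \<Longrightarrow> real ((a + b) choose a) \<le> H a b"
  shows "real (card {K. K \<subseteq> I \<and> card K = a \<and> crosses P x I K}) \<le> H a (card I - a)"
  using assms(1-3)
proof (induction "card I" arbitrary: I a)
  case 0
  then show ?case using nonneg by (simp add: crosses_def)
next
  case (Suc N)
  have ne: "I \<noteq> {}" using Suc.hyps(2) by auto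
  \<comment> \<open>The smallest score is the last step of the path.\<close>
  obtain i0 where i0: "i0 \<in> I" and min: "\<And>i. i \<in> I \<Longrightarrow> x i0 \<le> x i"
    using ex_is_arg_min_if_finite[OF Suc.prems(1) ne, of x] by (auto simp: is_arg_min_linorder)
  have min_strict: "x i0 < x i" if "i \<in> I" "i \<noteq> i0" for i
    using min[OF that(1)] inj_onD[OF Suc.prems(2) _ i0 that(1)] that(2) by (metis order_le_less)
  define J where "J = I - {i0}"
  have J: "finite J" "inj_on x J" "card J = N" "I = insert i0 J" "i0 \<notin> J"
    using Suc.prems Suc.hyps(2) i0 by (auto simp: J_def inj_on_def)
  define C where "C I a = {K. K \<subseteq> I \<and> card K = a \<and> crosses P x I K}" for I a
  have finC: "finite (C I a)" if "finite I" for I a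
    by (rule finite_subset[of _ "Pow I"]) (use that in \<open>auto simp: C_def\<close>)
  show ?case
  \<comment> \<open>If the end point satisfies \<open>P\<close>, the count of all paths suffices.
    Otherwise the crossing occurs before the last step and survives the removal of
    \<open>i0\<close>.\<close>
  proof (cases "P a (card I - a)")
    case True
    have "card (C I a) \<le> card {K. K \<subseteq> I \<and> card K = a}"
      by (rule card_mono) (use Suc.prems in \<open>auto simp: C_def intro: finite_subset[of _ "Pow I"]\<close>)
    also have "\<dots> = card I choose a" using Suc.prems by (simp add: n_subsets)
    finally have "real (card (C I a)) \<le> real ((a + (card I - a)) choose a)"
      using Suc.prems by simp
    also have "\<dots> \<le> H a (card I - a)" by (rule bound[OF True])
    finally show ?thesis by (simp add: C_def)
  next
    case False
    have restrict: "crosses P x J (K - {i0})" if K: "K \<subseteq> I" "card K = a" "crosses P x I K" for K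
    proof -
      obtain i where i: "i \<in> I" "P (card {k\<in>K. x i \<le> x k}) (card {k\<in>I - K. x i \<le> x k})"
        using K(3) by (auto simp: crosses_def)
      have "i \<noteq> i0"
      proof
        assume "i = i0"
        then have "{k\<in>K. x i \<le> x k} = K" "{k\<in>I - K. x i \<le> x k} = I - K" using min K by auto
        then show False
          using i False K Suc.prems(1) by (simp add: card_Diff_subset finite_subset)
      qed
      then have "i \<in> J" "\<not> x i \<le> x i0" using i min_strict[of i] by (auto simp: J_def)
      moreover from this have "{k\<in>K. x i \<le> x k} = {k\<in>K - {i0}. x i \<le> x k}"
        "{k\<in>I - K. x i \<le> x k} = {k\<in>J - (K - {i0}). x i \<le> x k}" by (auto simp: J_def)
      ultimately show ?thesis using i by (auto simp: crosses_def)
    qed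
    have split: "C I a \<subseteq> C J a \<union> (if a = 0 then {} else insert i0 ` C J (a - 1))"
    proof
      fix K assume "K \<in> C I a"
      then have K: "K \<subseteq> I" "card K = a" "crosses P x I K" by (auto simp: C_def)
      note r = restrict[OF K]
      have "finite K" using K Suc.prems finite_subset by blast
      show "K \<in> C J a \<union> (if a = 0 then {} else insert i0 ` C J (a - 1))"
      proof (cases "i0 \<in> K")
        case True
        then have "a \<noteq> 0" "card (K - {i0}) = a - 1" and K_eq: "K = insert i0 (K - {i0})"
          using K \<open>finite K\<close> by (auto simp: card_gt_0_iff)
        moreover have "K - {i0} \<subseteq> J" using K by (auto simp: J_def)
        ultimately have "K - {i0} \<in> C J (a - 1)" using r by (simp add: C_def)
        then have "K \<in> insert i0 ` C J (a - 1)" by (rule rev_image_eqI) (rule K_eq)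
        then show ?thesis using \<open>a \<noteq> 0\<close> by simp
      next
        case False
        then have "K - {i0} = K" "K \<subseteq> J" using K by (auto simp: J_def)
        then show ?thesis using r K by (auto simp: C_def)
      qed
    qed
    have full: "C J a = {}" if "a = Suc N"
    proof -
      have "card K \<noteq> Suc N" if "K \<subseteq> J" for K using card_mono[OF J(1) that] J(3) by simp
      then show ?thesis using that by (auto simp: C_def)
    qed
    have IH: "real (card (C J a')) \<le> H a' (N - a')" if "a' \<le> N" for a'
      using Suc.hyps(1)[of J a'] J that by (simp add: C_def)
    have aN: "a \<le> Suc N" using Suc by simp
    have cI: "card I = Suc N" using Suc by simp
    show ?thesis
    proof (cases a)
      case 0
      then have "card (C I a) \<le> card (C J 0)" using split finC[OF J(1)] by (auto intro: card_mono)
      then have "real (card (C I a)) \<le> H 0 N" using IH[of 0] by simp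
      also have "\<dots> \<le> H 0 (Suc N)" by (rule right)
      finally show ?thesis using 0 cI by (simp add: C_def)
    next
      case (Suc a')
      have "card (C I a) \<le> card (C J a \<union> insert i0 ` C J a')"
        using split finC[OF J(1)] Suc by (intro card_mono) auto
      also have "\<dots> \<le> card (C J a) + card (insert i0 ` C J a')" by (rule card_Un_le)
      also have "\<dots> \<le> card (C J a) + card (C J a')" using finC[OF J(1)] by (simp add: card_image_le)
      finally have le: "real (card (C I a)) \<le> real (card (C J a)) + real (card (C J a'))" by simp
      have a': "a' \<le> N" using aN Suc by simp
      show ?thesis
      \<comment> \<open>All steps are marked here, so the path has only one predecessor and
        \<open>left\<close> takes the place of \<open>pascal\<close>.\<close>
      proof (cases "a = Suc N")
        case True
        then have "real (card (C I a)) \<le> H a' (N - a')" using le full IH[OF a'] by simp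
        also have "\<dots> \<le> H a (card I - a)" using True Suc cI left[of a'] by simp
        finally show ?thesis by (simp add: C_def)
      next
        case False
        then have "a \<le> N" using aN by simp
        then obtain b where b: "N = Suc a' + b" using Suc le_Suc_ex by blast
        have "real (card (C I a)) \<le> H a (N - a) + H a' (N - a')" using le IH[OF \<open>a \<le> N\<close>] IH[OF a'] by simp
        also have "\<dots> = H a' (Suc b) + H (Suc a') b" using b Suc by simp
        also have "\<dots> \<le> H (Suc a') (Suc b)" by (rule pascal)
        also have "\<dots> = H a (card I - a)" using b Suc cI by simp
        finally show ?thesis by (simp add: C_def)
      qed
    qed
  qed
qed

text \<open>For natural y the left side counts lattice paths to (a + y, b), and the generalised
  binomial extends this to real y. The induction multiplies by \<open>Suc b\<close> and uses the
  absorption identity for both binomials.\<close>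

lemma gbinomial_shift_eq_prod:
  fixes y :: real
  shows "(real a + real b + y) gchoose b = real ((a + b) choose b) * (\<Prod>j<b. 1 + y / (real a + 1 + real j))"
proof (induction b)
  case (Suc b)
  have "real (Suc b) * ((real a + real b + y + 1) gchoose Suc b) = (real a + real b + y + 1) * ((real a + real b + y) gchoose b)"
    using gbinomial_factors[of "real a + real b + y" b] by (simp add: field_simps)
  also have "\<dots> = (real a + real b + 1) * real ((a + b) choose b) * (\<Prod>j<Suc b. 1 + y / (real a + 1 + real j))"
    unfolding Suc.IH by (simp add: field_simps)
  also have "(real a + real b + 1) * real ((a + b) choose b) = real (Suc b) * real ((a + Suc b) choose Suc b)"
    using Suc_times_binomial_eq[of "a + b" b] by (simp add: algebra_simps flip: of_nat_mult of_nat_add of_nat_Suc)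
  finally have "real (Suc b) * ((real a + real b + y + 1) gchoose Suc b) =
     real (Suc b) * (real ((a + Suc b) choose Suc b) * (\<Prod>j<Suc b. 1 + y / (real a + 1 + real j)))"
    by (simp only: mult.assoc)
  then have "(real a + real b + y + 1) gchoose Suc b = real ((a + Suc b) choose Suc b) * (\<Prod>j<Suc b. 1 + y / (real a + 1 + real j))"
    by (subst (asm) mult_cancel_left) auto
  moreover have "real a + real (Suc b) + y = real a + real b + y + 1" by simp
  ultimately show ?case by (simp only:)
qed simp

text \<open>The quotient of the two products is the likelihood ratio, at the crossing point, of a uniform
  path to \<open>(n + y, m)\<close> against a uniform path to \<open>(n, m)\<close>; real \<open>y\<close> is allowed.\<close>

lemma card_crosses_le_tilted:
  fixes x :: "'i \<Rightarrow> real" and y c :: real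
  assumes I: "finite I" "inj_on x I" "card I = n + m" and y: "y \<ge> 0" and c: "c > 0"
    and bound: "\<And>a b. P a b \<Longrightarrow>
      c * (\<Prod>j<m. 1 + y / (real n + 1 + real j)) \<le> (\<Prod>j<b. 1 + y / (real a + 1 + real j))"
  shows "c * real (card {K. K \<subseteq> I \<and> card K = n \<and> crosses P x I K}) \<le> real ((n + m) choose n)"
proof -
  define R where "R a b = (\<Prod>j<b. 1 + y / (real a + 1 + real j))" for a b :: nat
  have R_pos: "R a b > 0" for a b
    unfolding R_def using y by (intro prod_pos) (auto intro!: add_pos_nonneg)
  define G where "G a b = (real a + real b + y) gchoose b" for a b :: nat
  have G: "G a b = real ((a + b) choose b) * R a b" for a b
    unfolding G_def R_def by (rule gbinomial_shift_eq_prod)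
  \<comment> \<open>Dividing by \<open>d\<close> makes \<open>H n m\<close> the number of all paths
    over \<open>c\<close>. Pascal's rule holds for \<open>G\<close> with equality, also for real
    y.\<close>
  define d where "d = c * R n m"
  have d: "d > 0" using c R_pos by (simp add: d_def)
  define H where "H a b = G a b / d" for a b
  have "real (card {K. K \<subseteq> I \<and> card K = n \<and> crosses P x I K}) \<le> H n (card I - n)"
  proof (rule card_crosses_le[OF I(1,2)])
    show "n \<le> card I" using I by simp
    show "0 \<le> H a b" for a b using d R_pos[of a b] by (simp add: H_def G less_imp_le)
    have pas: "G a (Suc b) + G (Suc a) b = G (Suc a) (Suc b)" for a b
    proof -
      have "G (Suc a) (Suc b) = ((real a + real b + y + 1) + 1) gchoose Suc b" by (simp add: G_def add_ac)
      also have "\<dots> = ((real a + real b + y + 1) gchoose b) + ((real a + real b + y + 1) gchoose Suc b)"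
        by (rule gbinomial_Suc_Suc)
      finally show ?thesis by (simp add: G_def add_ac)
    qed
    show "H a (Suc b) + H (Suc a) b \<le> H (Suc a) (Suc b)" for a b
      using pas[of a b] by (simp add: H_def flip: add_divide_distrib)
    show "H a 0 \<le> H (Suc a) 0" for a by (simp add: H_def G_def)
    show "H 0 b \<le> H 0 (Suc b)" for b
    proof -
      have "R 0 b * 1 \<le> R 0 b * (1 + y / (1 + real b))" 
        using R_pos[of 0 b] y by (intro mult_left_mono) auto
      then have "G 0 b \<le> G 0 (Suc b)" by (simp add: G R_def)
      then show ?thesis using d by (simp add: H_def divide_right_mono)
    qed
    show "real ((a + b) choose a) \<le> H a b" if "P a b" for a b
    proof -
      have "d \<le> R a b" using bound[OF that] by (simp add: d_def R_def)
      then have "real ((a + b) choose b) * d \<le> G a b" unfolding G by (intro mult_left_mono) auto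
      then show ?thesis using d binomial_symmetric[of a "a + b"] by (simp add: H_def field_simps)
    qed
  qed
  also have "\<dots> = real ((n + m) choose n) / c"
    using I binomial_symmetric[of n "n + m"] R_pos[of n m] by (simp add: H_def G d_def)
  finally show ?thesis using c by (simp add: field_simps)
qed

subsection \<open>Exchangeable scores\<close>

lemma crosses_comp_permutes:
  assumes \<sigma>: "\<sigma> permutes I" and K: "K \<subseteq> I"
  shows "crosses P (\<lambda>i. x (\<sigma> i)) I K \<longleftrightarrow> crosses P x I (\<sigma> ` K)"
proof -
  have inj: "inj \<sigma>" using \<sigma> by (rule permutes_inj)
  have card: "card {k \<in> A. t \<le> x (\<sigma> k)} = card {k \<in> \<sigma> ` A. t \<le> x k}" for t A
  proof -
    have "{k \<in> \<sigma> ` A. t \<le> x k} = \<sigma> ` {k \<in> A. t \<le> x (\<sigma> k)}" by auto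
    then show ?thesis using inj by (simp add: card_image inj_on_subset)
  qed
  have diff: "\<sigma> ` (I - K) = I - \<sigma> ` K"
    using inj \<sigma> by (simp add: image_set_diff permutes_image)
  have "crosses P (\<lambda>i. x (\<sigma> i)) I K \<longleftrightarrow>
     (\<exists>i\<in>I. P (card {k \<in> \<sigma> ` K. x (\<sigma> i) \<le> x k}) (card {k \<in> I - \<sigma> ` K. x (\<sigma> i) \<le> x k}))"
    unfolding crosses_def card diff ..
  also have "\<dots> \<longleftrightarrow> (\<exists>i\<in>\<sigma> ` I. P (card {k \<in> \<sigma> ` K. x i \<le> x k}) (card {k \<in> I - \<sigma> ` K. x i \<le> x k}))"
    by simp
  finally show ?thesis using \<sigma> by (simp add: permutes_image crosses_def)
qed

lemma measurable_crosses:
  fixes S :: "'i \<Rightarrow> 'a \<Rightarrow> real"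
  assumes "finite I" "K \<subseteq> I" and S [measurable]: "\<And>i. i \<in> I \<Longrightarrow> S i \<in> borel_measurable M"
  shows "{\<omega> \<in> space M. crosses P (\<lambda>i. S i \<omega>) I K} \<in> sets M"
proof -
  have count: "(\<lambda>\<omega>. card {k \<in> A. S i \<omega> \<le> S k \<omega>}) \<in> measurable M (count_space UNIV)"
    if "A \<subseteq> I" "i \<in> I" for A i
  proof -
    have finA: "finite A" using that assms finite_subset by blast
    have "{\<omega> \<in> space M. card {k \<in> A. S i \<omega> \<le> S k \<omega>} = c} \<in> sets M" for c
    proof -
      have eq: "(card {k \<in> A. S i \<omega> \<le> S k \<omega>} = c) \<longleftrightarrow> (\<Sum>k\<in>A. if S i \<omega> \<le> S k \<omega> then 1 else 0 :: real) = real c" for \<omega>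
        using finA by (simp add: sum.If_cases Int_def)
      have meas: "(\<lambda>\<omega>. \<Sum>k\<in>A. if S i \<omega> \<le> S k \<omega> then 1 else 0 :: real) \<in> borel_measurable M"
        using that by (intro borel_measurable_sum measurable_If borel_measurable_le) auto
      show ?thesis unfolding eq using meas by measurable
    qed
    then show ?thesis
      by (subst measurable_count_space_eq2_countable) (auto simp: vimage_def Int_def conj_commute)
  qed
  have "{\<omega> \<in> space M. P (card {k\<in>K. S i \<omega> \<le> S k \<omega>}) (card {k\<in>I - K. S i \<omega> \<le> S k \<omega>})} \<in> sets M"
    if "i \<in> I" for i
  proof -
    have [measurable]: "(\<lambda>\<omega>. card {k \<in> K. S i \<omega> \<le> S k \<omega>}) \<in> measurable M (count_space UNIV)"
      "(\<lambda>\<omega>. card {k \<in> I - K. S i \<omega> \<le> S k \<omega>}) \<in> measurable M (count_space UNIV)"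
      by (rule count; use assms that in auto)+
    show ?thesis by measurable
  qed
  then have "(\<Union>i\<in>I. {\<omega> \<in> space M. P (card {k\<in>K. S i \<omega> \<le> S k \<omega>}) (card {k\<in>I - K. S i \<omega> \<le> S k \<omega>})}) \<in> sets M"
    using assms(1) by (intro sets.finite_UN) auto
  also have "(\<Union>i\<in>I. {\<omega> \<in> space M. P (card {k\<in>K. S i \<omega> \<le> S k \<omega>}) (card {k\<in>I - K. S i \<omega> \<le> S k \<omega>})}) =
     {\<omega> \<in> space M. crosses P (\<lambda>i. S i \<omega>) I K}"
    by (auto simp: crosses_def)
  finally show ?thesis .
qed

lemma exists_permutes_image_eq:
  assumes "finite I" "A \<subseteq> I" "K \<subseteq> I" "card A = card K"
  shows "\<exists>\<sigma>. \<sigma> permutes I \<and> \<sigma> ` A = K"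
proof -
  have fin: "finite A" "finite K" using assms finite_subset by auto
  obtain f where f: "bij_betw f A K" using finite_same_card_bij[OF fin assms(4)] by blast
  have "card (I - A) = card (I - K)" using assms fin by (simp add: card_Diff_subset)
  then obtain g where g: "bij_betw g (I - A) (I - K)"
    using finite_same_card_bij[of "I - A" "I - K"] assms(1) by auto
  define \<sigma> where "\<sigma> i = (if i \<in> A then f i else if i \<in> I then g i else i)" for i
  have "bij_betw \<sigma> A K" using f by (subst bij_betw_cong[of A \<sigma> f]) (auto simp: \<sigma>_def)
  moreover have "bij_betw \<sigma> (I - A) (I - K)" using g by (subst bij_betw_cong[of "I - A" \<sigma> g]) (auto simp: \<sigma>_def)
  ultimately have "bij_betw \<sigma> (A \<union> (I - A)) (K \<union> (I - K))" by (rule bij_betw_combine) auto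
  then have "bij_betw \<sigma> I I" using assms by (simp add: Un_absorb1)
  moreover have "\<sigma> i = i" if "i \<notin> I" for i using that assms by (auto simp: \<sigma>_def)
  ultimately have "\<sigma> permutes I" by (rule bij_imp_permutes)
  then show ?thesis using \<open>bij_betw \<sigma> A K\<close> by (auto simp: bij_betw_def)
qed

text \<open>For a permutation taking \<open>A\<close> to \<open>K\<close>, marking \<open>A\<close>
  in the permuted scores is the same as marking \<open>K\<close> in the original ones. Hence the
  marked set behaves like a uniformly chosen set of its size.\<close>

lemma exchangeable_crosses_eq:
  fixes S :: "nat \<Rightarrow> 'a \<Rightarrow> real"
  assumes I: "finite I" and S: "\<And>i. i \<in> I \<Longrightarrow> S i \<in> borel_measurable M"
    and exch: "exchangeable M I S" and A: "A \<subseteq> I" "K \<subseteq> I" "card A = card K"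
  shows "measure M {\<omega> \<in> space M. crosses P (\<lambda>i. S i \<omega>) I A} = measure M {\<omega> \<in> space M. crosses P (\<lambda>i. S i \<omega>) I K}"
proof -
  obtain \<sigma> where \<sigma>: "\<sigma> permutes I" "\<sigma> ` A = K" using exists_permutes_image_eq[OF I A] by blast
  let ?N = "PiM I (\<lambda>_. borel :: real measure)"
  let ?E = "{x \<in> space ?N. crosses P x I A}"
  have cong: "crosses P (\<lambda>i\<in>I. x i) I A \<longleftrightarrow> crosses P x I A" for x
  proof -
    have "{k \<in> A. (\<lambda>i\<in>I. x i) i \<le> (\<lambda>i\<in>I. x i) k} = {k \<in> A. x i \<le> x k}"
      "{k \<in> I - A. (\<lambda>i\<in>I. x i) i \<le> (\<lambda>i\<in>I. x i) k} = {k \<in> I - A. x i \<le> x k}" if "i \<in> I" for i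
      using that A by auto
    then show ?thesis unfolding crosses_def by (intro bex_cong) simp_all
  qed
  have E: "?E \<in> sets ?N"
    by (rule measurable_crosses[OF I A(1), where S = "\<lambda>i x. x i"]) (rule measurable_component_singleton)
  have meas: "(\<lambda>\<omega>. \<lambda>i\<in>I. S (\<pi> i) \<omega>) \<in> measurable M ?N" if "\<pi> permutes I" for \<pi>
    using that S by (intro measurable_restrict) (auto simp: permutes_in_image)
  have pre: "measure (distr M ?N (\<lambda>\<omega>. \<lambda>i\<in>I. S (\<pi> i) \<omega>)) ?E = measure M {\<omega> \<in> space M. crosses P (\<lambda>i. S (\<pi> i) \<omega>) I A}"
    if "\<pi> permutes I" for \<pi>
  proof -
    have "(\<lambda>\<omega>. \<lambda>i\<in>I. S (\<pi> i) \<omega>) -` ?E \<inter> space M = {\<omega> \<in> space M. crosses P (\<lambda>i. S (\<pi> i) \<omega>) I A}"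
      using measurable_space[OF meas[OF that]] by (auto simp: cong)
    then show ?thesis by (simp add: measure_distr[OF meas[OF that] E])
  qed
  have "measure M {\<omega> \<in> space M. crosses P (\<lambda>i. S (id i) \<omega>) I A} =
     measure M {\<omega> \<in> space M. crosses P (\<lambda>i. S (\<sigma> i) \<omega>) I A}"
    using exch[unfolded exchangeable_def, rule_format, OF \<sigma>(1)] pre[OF \<sigma>(1)] pre[OF permutes_id] by simp
  also have "\<dots> = measure M {\<omega> \<in> space M. crosses P (\<lambda>i. S i \<omega>) I K}"
    using crosses_comp_permutes[OF \<sigma>(1) A(1), of P "\<lambda>i. S i _"] \<sigma>(2) by simp
  finally show ?thesis by simp
qed

text \<open>By symmetry the probability for \<open>A\<close> is the average over all sets of the
  same size. Moving the sum inside the expectation leaves, for each outcome without ties, a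
  deterministic number of crossing sets, which \<open>count\<close> bounds.\<close>

lemma exchangeable_crosses_le:
  fixes S :: "nat \<Rightarrow> 'a \<Rightarrow> real"
  assumes "prob_space M" and I: "finite I" and S: "\<And>i. i \<in> I \<Longrightarrow> S i \<in> borel_measurable M"
    and exch: "exchangeable M I S" and ties: "no_ties M I S" and A: "A \<subseteq> I"
    and count: "\<And>x. inj_on x I \<Longrightarrow>
       c * real (card {K. K \<subseteq> I \<and> card K = card A \<and> crosses P x I K}) \<le> real (card I choose card A)"
    and c: "c > 0"
  shows "measure M {\<omega> \<in> space M. crosses P (\<lambda>i. S i \<omega>) I A} \<le> 1 / c"
proof -
  interpret prob_space M by fact
  define \<K> where "\<K> = {K. K \<subseteq> I \<and> card K = card A}"
  define E where "E K = {\<omega> \<in> space M. crosses P (\<lambda>i. S i \<omega>) I K}" for K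
  have fin: "finite \<K>" unfolding \<K>_def by (rule finite_subset[of _ "Pow I"]) (use I in auto)
  have cardK: "card \<K> = card I choose card A" using I by (simp add: \<K>_def n_subsets)
  have E: "E K \<in> sets M" if "K \<in> \<K>" for K
    using that unfolding E_def \<K>_def by (intro measurable_crosses[OF I _ S]) auto
  have "real (card \<K>) * measure M (E A) = (\<Sum>K\<in>\<K>. measure M (E K))"
  proof -
    have "measure M (E K) = measure M (E A)" if "K \<in> \<K>" for K
      using exchangeable_crosses_eq[OF I S exch A, of K P] that by (auto simp: E_def \<K>_def)
    then show ?thesis by simp
  qed
  also have "\<dots> = (\<integral>\<omega>. (\<Sum>K\<in>\<K>. indicator (E K) \<omega>) \<partial>M)"
    using E by (subst Bochner_Integration.integral_sum) (auto simp: integrable_real_indicator emeasure_eq_measure)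
  also have "\<dots> \<le> real (card \<K>) / c"
  proof (rule integral_le_const)
    show "integrable M (\<lambda>\<omega>. \<Sum>K\<in>\<K>. indicator (E K) \<omega> :: real)"
      using E by (intro Bochner_Integration.integrable_sum integrable_real_indicator) (auto simp: emeasure_eq_measure)
    have "AE \<omega> in M. inj_on (\<lambda>i. S i \<omega>) I"
      using ties unfolding no_ties_def by eventually_elim (auto simp: inj_on_def)
    then have "AE \<omega> in M. \<omega> \<in> space M \<and> inj_on (\<lambda>i. S i \<omega>) I" by simp
    then show "AE \<omega> in M. (\<Sum>K\<in>\<K>. indicator (E K) \<omega>) \<le> real (card \<K>) / c"
    proof eventually_elim
      case (elim \<omega>)
      have "(\<Sum>K\<in>\<K>. indicator (E K) \<omega> :: real) = real (card {K \<in> \<K>. crosses P (\<lambda>i. S i \<omega>) I K})"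
        using fin elim by (simp add: indicator_def E_def sum.If_cases Int_def)
      also have "{K \<in> \<K>. crosses P (\<lambda>i. S i \<omega>) I K} = {K. K \<subseteq> I \<and> card K = card A \<and> crosses P (\<lambda>i. S i \<omega>) I K}"
        by (auto simp: \<K>_def)
      finally show ?case using count[of "\<lambda>i. S i \<omega>"] elim c cardK by (simp add: field_simps)
    qed
  qed
  finally have "real (card \<K>) * measure M (E A) \<le> real (card \<K>) * (1 / c)" by simp
  moreover have "real (card \<K>) > 0" using fin A by (auto simp: card_gt_0_iff \<K>_def)
  ultimately have "measure M (E A) \<le> 1 / c" by (rule mult_left_le_imp_le)
  then show ?thesis by (simp add: E_def)
qed

section \<open>The crossing behind the supremum, the threshold iteration and the final bound\<close>

lemma prod_one_plus_divide_eq_exp: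
  fixes x y :: real
  assumes "x > 0" "y \<ge> 0"
  shows "(\<Prod>j<k. 1 + y / (x + real j)) = exp (\<Sum>j<k. ln (x + real j + y) - ln (x + real j))"
proof -
  have "1 + y / (x + real j) = exp (ln (x + real j + y) - ln (x + real j))" for j
  proof -
    have "x + real j > 0" "x + real j + y > 0" using assms by auto
    then show ?thesis by (simp add: exp_diff field_simps)
  qed
  then show ?thesis by (simp add: exp_sum)
qed

text \<open>Among the test points with p-value at most t, let \<open>i0\<close> have the smallest
  score. Its p-value is (a + 1) / (n + 1), and all these test points score at least as high, so b is
  at least their number. The path therefore crosses at \<open>n + i0\<close>.\<close>

lemma sup_gt_imp_crosses:
  fixes S :: "nat \<Rightarrow> 'a \<Rightarrow> real"
  assumes lam: "lam > 0"
    and sup: "(SUP t\<in>{0..1}. Fhat n m S t \<omega> - In_fun n t) > lam"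
  shows "crosses (\<lambda>a b. lam + (real a + 1) / (real n + 1) < real b / real m \<and> b \<le> m)
     (\<lambda>i. S i \<omega>) {1..n+m} {1..n}"
proof -
  obtain t where t: "t \<in> {0..1}" "lam < Fhat n m S t \<omega> - In_fun n t"
  proof (rule ccontr)
    assume "\<not> thesis"
    then have "(SUP t\<in>{0..1}. Fhat n m S t \<omega> - In_fun n t) \<le> lam"
      using that by (intro cSUP_least) (auto simp: not_less[symmetric])
    with sup show False by simp
  qed
  define B where "B = {i \<in> {1..m}. pval n S i \<omega> \<le> t}"
  have In: "In_fun n t \<ge> 0" using t by (simp add: In_fun_def)
  have "B \<noteq> {}"
  proof
    assume "B = {}"
    then have "Fhat n m S t \<omega> = 0" unfolding Fhat_def B_def by simp
    with t lam In show False by simp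
  qed
  then obtain i0 where i0: "i0 \<in> B" and min: "\<And>i. i \<in> B \<Longrightarrow> S (n + i0) \<omega> \<le> S (n + i) \<omega>"
    using ex_is_arg_min_if_finite[of B "\<lambda>i. S (n + i) \<omega>"] by (auto simp: is_arg_min_linorder B_def)
  define a where "a = card {k \<in> {1..n}. S (n + i0) \<omega> \<le> S k \<omega>}"
  define b where "b = card {k \<in> {1..n+m} - {1..n}. S (n + i0) \<omega> \<le> S k \<omega>}"
  have "(1 + real a) / (real n + 1) \<le> t" using i0 by (simp add: B_def pval_def a_def)
  then have "real_of_int (int (1 + a)) \<le> (real n + 1) * t" by (simp add: field_simps)
  \<comment> \<open>The p-value lies on the grid of multiples of 1 / (n + 1), so rounding t down to
    that grid keeps the inequality.\<close>
  then have "int (1 + a) \<le> \<lfloor>(real n + 1) * t\<rfloor>" by (subst le_floor_iff)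
  then have "real_of_int (int (1 + a)) \<le> real_of_int \<lfloor>(real n + 1) * t\<rfloor>" by (simp only: of_int_le_iff)
  then have a_le: "(real a + 1) / (real n + 1) \<le> In_fun n t"
    unfolding In_fun_def by (intro divide_right_mono) auto
  have "card B = card ((+) n ` B)" by (simp add: card_image)
  also have "\<dots> \<le> b" unfolding b_def using min by (intro card_mono) (auto simp: B_def)
  finally have "Fhat n m S t \<omega> \<le> real b / real m"
    unfolding Fhat_def B_def[symmetric] by (intro divide_right_mono) auto
  moreover have "b \<le> m"
  proof -
    have "b \<le> card ({1..n+m} - {1..n})" unfolding b_def by (intro card_mono) auto
    also have "\<dots> = m" by (simp add: card_Diff_subset)
    finally show ?thesis .
  qed
  ultimately have "lam + (real a + 1) / (real n + 1) < real b / real m \<and> b \<le> m"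
    using t a_le by linarith
  moreover have "n + i0 \<in> {1..n+m}" using i0 by (auto simp: B_def)
  ultimately show ?thesis unfolding crosses_def a_def b_def by blast
qed

text \<open>\<open>\<Psi>\<close> is monotone and at most 1, so its iterates from 1 decrease and the
  last one, v = \<open>\<Psi> u\<close>, satisfies v <= u. If v < 1, the exponential at v is exactly
  \<open>\<delta> / (1 + c * u)\<close>, and the prefactor 1 + c v is at most 1 + c u. If v = 1, the
  indicator makes the bound 0.\<close>

lemma B_DKW_lambda_DKW_le:
  assumes "n \<ge> 1" "m \<ge> 1" and \<delta>: "0 < \<delta>" "\<delta> < 1" and r: "r \<ge> 1"
  shows "B_DKW (lambda_DKW \<delta> n m r) n m \<le> \<delta>"
proof -
  define c where "c = 2 * sqrt (2 * pi) * tau n m / sqrt (real n + real m)"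
  have tau: "tau n m > 0" using assms by (simp add: tau_def)
  have c: "c \<ge> 0" using tau by (simp add: c_def)
  define \<Psi> where "\<Psi> = Psi_DKW \<delta> n m"
  define f where "f x = (ln (1 / \<delta>) + ln (1 + c * x)) / (2 * tau n m)" for x
  have \<Psi>: "\<Psi> x = min 1 (sqrt (f x))" for x
    by (simp add: \<Psi>_def Psi_DKW_def f_def c_def mult_ac)
  have f_mono: "f x \<le> f y" if "0 \<le> x" "x \<le> y" for x y
  proof -
    have "1 + c * x > 0" "c * x \<le> c * y" using c that by (auto intro: add_pos_nonneg mult_left_mono)
    then show ?thesis unfolding f_def using tau by (intro divide_right_mono) auto
  qed
  have f_nonneg: "f x \<ge> 0" if "0 \<le> x" for x
    using tau c that \<delta> by (simp add: f_def)
  have \<Psi>_mono: "\<Psi> x \<le> \<Psi> y" if "0 \<le> x" "x \<le> y" for x y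
    unfolding \<Psi> using f_mono[OF that] by (intro min.mono) auto
  have \<Psi>_nonneg: "0 \<le> \<Psi> x" if "0 \<le> x" for x
    unfolding \<Psi> using f_nonneg[OF that] by simp
  have iter: "0 \<le> (\<Psi> ^^ Suc k) 1 \<and> (\<Psi> ^^ Suc k) 1 \<le> (\<Psi> ^^ k) 1" for k
  proof (induction k)
    case 0
    then show ?case using f_nonneg[of 1] by (simp add: \<Psi>)
  next
    case (Suc k)
    then show ?case using \<Psi>_mono[of "(\<Psi> ^^ Suc k) 1"] \<Psi>_nonneg[of "(\<Psi> ^^ Suc k) 1"] by simp
  qed
  obtain k where k: "r = Suc k" using r by (cases r) auto
  define u where "u = (\<Psi> ^^ k) 1"
  define v where "v = lambda_DKW \<delta> n m r"
  have v: "v = \<Psi> u" by (simp add: v_def lambda_DKW_def k u_def \<Psi>_def)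
  have vu: "0 \<le> v" "v \<le> u" using iter[of k] by (auto simp: v u_def)
  show ?thesis
  proof (cases "v < 1")
    case False
    then show ?thesis using \<delta> by (simp add: B_DKW_def v_def)
  next
    case True
    then have "v = sqrt (f u)" using v by (simp add: \<Psi> min_def split: if_splits)
    then have "v\<^sup>2 = f u" using f_nonneg[of u] vu by simp
    then have "2 * tau n m * v\<^sup>2 = ln (1 / \<delta>) + ln (1 + c * u)" using tau by (simp add: f_def)
    moreover have cu: "1 + c * u > 0" using c vu by (auto intro!: add_pos_nonneg)
    ultimately have "exp (- 2 * tau n m * v\<^sup>2) = \<delta> / (1 + c * u)"
      using \<delta> by (simp add: ln_div exp_diff exp_minus exp_add divide_inverse)
    moreover have "B_DKW v n m = (1 + c * v) * exp (- 2 * tau n m * v\<^sup>2)"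
      using True by (simp add: B_DKW_def c_def mult_ac)
    moreover have "(1 + c * v) * (\<delta> / (1 + c * u)) \<le> \<delta>"
    proof -
      have "1 + c * v \<le> 1 + c * u" using c vu by (simp add: mult_left_mono)
      then have "(1 + c * v) * \<delta> \<le> (1 + c * u) * \<delta>" using \<delta> by (intro mult_right_mono) auto
      then show ?thesis using cu by (simp add: field_simps)
    qed
    ultimately show ?thesis by (simp add: v_def)
  qed
qed

theorem theorem1:
  fixes M :: "'a measure" and S :: "nat \<Rightarrow> 'a \<Rightarrow> real" and n m :: nat and lam :: real
  assumes "prob_space M"
    and "n \<ge> 1" and "m \<ge> 1"
    and "\<And>i. i \<in> {1..n+m} \<Longrightarrow> S i \<in> borel_measurable M"
    and "exchangeable M {1..n+m} S"
    and "no_ties M {1..n+m} S"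
    and "lam > 0"
  shows "measure M {\<omega> \<in> space M. (SUP t\<in>{0..1}. Fhat n m S t \<omega> - In_fun n t) > lam}
           \<le> B_DKW lam n m
         \<and> (\<forall>\<delta> r. 0 < \<delta> \<and> \<delta> < 1 \<and> r \<ge> 1 \<longrightarrow> B_DKW (lambda_DKW \<delta> n m r) n m \<le> \<delta>)"
proof
  interpret prob_space M by fact
  define P where "P a b \<longleftrightarrow> lam + (real a + 1) / (real n + 1) < real b / real m \<and> b \<le> m" for a b :: nat
  let ?I = "{1..n+m}"
  let ?E = "{\<omega> \<in> space M. crosses P (\<lambda>i. S i \<omega>) ?I {1..n}}"
  have E: "?E \<in> sets M" by (rule measurable_crosses) (use assms in auto)
  have "{\<omega> \<in> space M. (SUP t\<in>{0..1}. Fhat n m S t \<omega> - In_fun n t) > lam} \<subseteq> ?E"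
    using sup_gt_imp_crosses[OF assms(7), of n m S] unfolding P_def by auto
  \<comment> \<open>Measurability of the superset \<open>?E\<close> is enough, as
    \<open>measure\<close> gives 0 to sets outside \<open>sets M\<close>.\<close>
  then have le_E: "measure M {\<omega> \<in> space M. (SUP t\<in>{0..1}. Fhat n m S t \<omega> - In_fun n t) > lam} \<le> measure M ?E"
    using E by (rule finite_measure_mono)
  have "measure M ?E \<le> B_DKW lam n m"
  proof (cases "lam < 1")
    case False
    \<comment> \<open>As b / m <= 1, no lattice point lies beyond the boundary; this matches the
      indicator in \<open>B_DKW\<close>.\<close>
    have "\<not> P a b" for a b
    proof
      assume "P a b"
      then have "real b / real m \<le> 1" "lam + (real a + 1) / (real n + 1) < real b / real m"
        using assms(3) by (auto simp: P_def)
      moreover have "(real a + 1) / (real n + 1) > 0" by (simp add: add_pos_nonneg)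
      ultimately show False using False by linarith
    qed
    then have empty: "?E = {}" by (auto simp: crosses_def)
    show ?thesis unfolding empty using False by (simp add: B_DKW_def)
  next
    case True
    obtain y where y: "y > 0" and tilt: "\<And>A b. 0 < A \<Longrightarrow> b \<le> m \<Longrightarrow> lam + real A / (real n + 1) < real b / real m \<Longrightarrow>
       2 * tau n m * lam\<^sup>2 + (\<Sum>j<m. ln (real n + 1 + real j + y) - ln (real n + 1 + real j))
       \<le> (\<Sum>j<b. ln (real A + real j + y) - ln (real A + real j))"
      using exists_tilt[OF assms(2,3,7) True] by blast
    define c where "c = exp (2 * tau n m * lam\<^sup>2)"
    have c: "c > 0" by (simp add: c_def)
    have bound: "c * (\<Prod>j<m. 1 + y / (real n + 1 + real j)) \<le> (\<Prod>j<b. 1 + y / (real a + 1 + real j))"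
      if "P a b" for a b
    proof -
      have "2 * tau n m * lam\<^sup>2 + (\<Sum>j<m. ln (real n + 1 + real j + y) - ln (real n + 1 + real j))
         \<le> (\<Sum>j<b. ln (real a + 1 + real j + y) - ln (real a + 1 + real j))"
        using tilt[of "Suc a" b] that by (simp add: P_def add_ac)
      then show ?thesis
        using y by (simp add: prod_one_plus_divide_eq_exp c_def flip: exp_add)
    qed
    have "measure M ?E \<le> 1 / c"
    proof (rule exchangeable_crosses_le)
      fix x :: "nat \<Rightarrow> real" assume "inj_on x ?I"
      then show "c * real (card {K. K \<subseteq> ?I \<and> card K = card {1..n} \<and> crosses P x ?I K}) \<le> real (card ?I choose card {1..n})"
        using card_crosses_le_tilted[of ?I x n m y c P] y c bound by simp
    qed (use assms c in auto)
    also have "\<dots> = 1 * exp (- 2 * tau n m * lam\<^sup>2)" by (simp add: c_def exp_minus divide_inverse)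
    \<comment> \<open>The exponential has been obtained with prefactor 1, and the bracket in
      \<open>B_DKW\<close> is at least 1.\<close>
    also have "\<dots> \<le> (1 + 2 * sqrt (2 * pi) * lam * tau n m / sqrt (real n + real m)) * exp (- 2 * tau n m * lam\<^sup>2)"
      using assms(7) by (intro mult_right_mono) (auto simp: tau_def)
    also have "\<dots> = B_DKW lam n m" using True by (simp add: B_DKW_def)
    finally show ?thesis .
  qed
  with le_E show "measure M {\<omega> \<in> space M. (SUP t\<in>{0..1}. Fhat n m S t \<omega> - In_fun n t) > lam} \<le> B_DKW lam n m"
    by simp
  show "\<forall>\<delta> r. 0 < \<delta> \<and> \<delta> < 1 \<and> r \<ge> 1 \<longrightarrow> B_DKW (lambda_DKW \<delta> n m r) n m \<le> \<delta>"
    using B_DKW_lambda_DKW_le[OF assms(2,3)] by blast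
qed

end
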